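(* If $L$ is a non-trivial alternating link in $S^3$, then its involutory quandle $IQ(L)$ is not left-orderable.
   Context: A quandle is a set $Q$ with a binary operation $*$ such that $x*x=x$; for all $x,y$ there is a unique $z$ with $z*y=x$; and $(x*y)*z=(x*z)*(y*z)$. It is involutory if $(x*y)*y=x$ for all $x,y$. A left-order on $Q$ is a strict linear order $<$ such that $x<y$ implies $z*x<z*y$ for all $x,y,z\in Q$. $Q$ is left-orderable if it has a left-order; by convention a trivial quandle (one with $x*y=x$ for all $x,y$), in particular the one-element quandle, is not considered left-orderable. For a diagram $D$ of a link $L$, the involutory quandle $IQ(L)$ is the involutory quandle generated by the arcs of $D$ with, for each crossing with over-arc $y$ and under-arcs $x,z$, the relation $z=x*y$. It is an invariant of the unoriented link $L$. A link is alternating if it has an alternating diagram, and non-trivial if it is not an unlink (a trivial link with one or more components). *)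

theory Defs
  imports "HOL-Library.Multiset"
begin

section \<open>Quandles and left-orders\<close>

record 'a magma =
  elems :: "'a set"
  star :: "'a \<Rightarrow> 'a \<Rightarrow> 'a" (infixl "\<star>\<index>" 70)

definition quandle :: "('a, 'm) magma_scheme \<Rightarrow> bool" where
  "quandle Q \<longleftrightarrow>
     (\<forall>x\<in>elems Q. \<forall>y\<in>elems Q. x \<star>\<^bsub>Q\<^esub> y \<in> elems Q) \<and>
     (\<forall>x\<in>elems Q. x \<star>\<^bsub>Q\<^esub> x = x) \<and>
     (\<forall>x\<in>elems Q. \<forall>y\<in>elems Q. \<exists>!z. z \<in> elems Q \<and> z \<star>\<^bsub>Q\<^esub> y = x) \<and>
     (\<forall>x\<in>elems Q. \<forall>y\<in>elems Q. \<forall>z\<in>elems Q.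
        (x \<star>\<^bsub>Q\<^esub> y) \<star>\<^bsub>Q\<^esub> z = (x \<star>\<^bsub>Q\<^esub> z) \<star>\<^bsub>Q\<^esub> (y \<star>\<^bsub>Q\<^esub> z))"

definition involutory_quandle :: "('a, 'm) magma_scheme \<Rightarrow> bool" where
  "involutory_quandle Q \<longleftrightarrow> quandle Q \<and>
     (\<forall>x\<in>elems Q. \<forall>y\<in>elems Q. (x \<star>\<^bsub>Q\<^esub> y) \<star>\<^bsub>Q\<^esub> y = x)"

definition trivial_quandle :: "('a, 'm) magma_scheme \<Rightarrow> bool" where
  "trivial_quandle Q \<longleftrightarrow> (\<forall>x\<in>elems Q. \<forall>y\<in>elems Q. x \<star>\<^bsub>Q\<^esub> y = x)"

definition left_order_on :: "('a, 'm) magma_scheme \<Rightarrow> ('a \<Rightarrow> 'a \<Rightarrow> bool) \<Rightarrow> bool" where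
  "left_order_on Q lt \<longleftrightarrow>
     irreflp_on (elems Q) lt \<and> transp_on (elems Q) lt \<and> totalp_on (elems Q) lt \<and>
     (\<forall>x\<in>elems Q. \<forall>y\<in>elems Q. \<forall>z\<in>elems Q. lt x y \<longrightarrow> lt (z \<star>\<^bsub>Q\<^esub> x) (z \<star>\<^bsub>Q\<^esub> y))"

definition left_orderable :: "('a, 'm) magma_scheme \<Rightarrow> bool" where
  "left_orderable Q \<longleftrightarrow> \<not> trivial_quandle Q \<and> (\<exists>lt. left_order_on Q lt)"


section \<open>Involutory quandles given by generators and relations\<close>

datatype 'g qterm = Gen 'g | Op "'g qterm" "'g qterm"

definition terms_over :: "'g set \<Rightarrow> 'g qterm set" where
  "terms_over G = {t. set_qterm t \<subseteq> G}"

inductive iq_eq :: "'g set \<Rightarrow> ('g qterm \<times> 'g qterm) set \<Rightarrow> 'g qterm \<Rightarrow> 'g qterm \<Rightarrow> bool"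
  for G R where
  rel: "(s, t) \<in> R \<Longrightarrow> s \<in> terms_over G \<Longrightarrow> t \<in> terms_over G \<Longrightarrow> iq_eq G R s t"
| refl: "s \<in> terms_over G \<Longrightarrow> iq_eq G R s s"
| sym: "iq_eq G R s t \<Longrightarrow> iq_eq G R t s"
| trans: "iq_eq G R s t \<Longrightarrow> iq_eq G R t u \<Longrightarrow> iq_eq G R s u"
| cong: "iq_eq G R s s' \<Longrightarrow> iq_eq G R t t' \<Longrightarrow> iq_eq G R (Op s t) (Op s' t')"
| idem: "s \<in> terms_over G \<Longrightarrow> iq_eq G R (Op s s) s"
| invol: "s \<in> terms_over G \<Longrightarrow> t \<in> terms_over G \<Longrightarrow> iq_eq G R (Op (Op s t) t) s"
| distrib: "s \<in> terms_over G \<Longrightarrow> t \<in> terms_over G \<Longrightarrow> u \<in> terms_over G \<Longrightarrow>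
    iq_eq G R (Op (Op s t) u) (Op (Op s u) (Op t u))"

definition iq_class :: "'g set \<Rightarrow> ('g qterm \<times> 'g qterm) set \<Rightarrow> 'g qterm \<Rightarrow> 'g qterm set" where
  "iq_class G R s = {t. iq_eq G R s t}"

definition presented_iq :: "'g set \<Rightarrow> ('g qterm \<times> 'g qterm) set \<Rightarrow> 'g qterm set magma" where
  "presented_iq G R =
     \<lparr> elems = iq_class G R ` terms_over G,
       star = (\<lambda>A B. {u. \<exists>s\<in>A. \<exists>t\<in>B. iq_eq G R (Op s t) u}) \<rparr>"

lemma iq_eq_terms: "iq_eq G R s t \<Longrightarrow> s \<in> terms_over G \<and> t \<in> terms_over G"
  by (induction rule: iq_eq.induct) (auto simp: terms_over_def)

lemma iq_class_eq_iff:
  assumes "s \<in> terms_over G"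
  shows "iq_class G R s = iq_class G R t \<longleftrightarrow> iq_eq G R s t"
  using assms unfolding iq_class_def by (blast intro: iq_eq.refl iq_eq.sym iq_eq.trans)

lemma star_iq_class:
  assumes "s \<in> terms_over G" "t \<in> terms_over G"
  shows "iq_class G R s \<star>\<^bsub>presented_iq G R\<^esub> iq_class G R t = iq_class G R (Op s t)"
  using assms unfolding presented_iq_def iq_class_def
  by (auto intro: iq_eq.refl iq_eq.trans iq_eq.cong)

lemma Op_terms_over: "s \<in> terms_over G \<Longrightarrow> t \<in> terms_over G \<Longrightarrow> Op s t \<in> terms_over G"
  by (simp add: terms_over_def)

lemma involutory_quandle_presented_iq: "involutory_quandle (presented_iq G R)"
proof -
  let ?Q = "presented_iq G R" and ?c = "iq_class G R"
  have el: "elems ?Q = ?c ` terms_over G" by (simp add: presented_iq_def)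
  have ex1: "\<exists>!z. z \<in> elems ?Q \<and> z \<star>\<^bsub>?Q\<^esub> y = x"
    if xy: "x \<in> elems ?Q" "y \<in> elems ?Q" for x y
  proof -
    from xy obtain s t where st: "s \<in> terms_over G" "t \<in> terms_over G" "x = ?c s" "y = ?c t"
      by (auto simp: el)
    show ?thesis
    proof (rule ex1I[of _ "?c (Op s t)"])
      show "?c (Op s t) \<in> elems ?Q \<and> ?c (Op s t) \<star>\<^bsub>?Q\<^esub> y = x"
        using st by (auto simp: el star_iq_class Op_terms_over iq_class_eq_iff intro: iq_eq.invol)
    next
      fix z assume z: "z \<in> elems ?Q \<and> z \<star>\<^bsub>?Q\<^esub> y = x"
      then obtain u where u: "u \<in> terms_over G" "z = ?c u" by (auto simp: el)
      have "iq_eq G R (Op u t) s"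
        using z st u by (simp add: star_iq_class Op_terms_over iq_class_eq_iff)
      then have "iq_eq G R (Op (Op u t) t) (Op s t)"
        using st by (auto intro: iq_eq.cong iq_eq.refl)
      then have "iq_eq G R u (Op s t)"
        using st u by (meson iq_eq.invol iq_eq.sym iq_eq.trans)
      then show "z = ?c (Op s t)"
        using u by (simp add: iq_class_eq_iff)
    qed
  qed
  show ?thesis
    unfolding involutory_quandle_def quandle_def using ex1
    by (auto simp: el star_iq_class Op_terms_over iq_class_eq_iff
        intro: iq_eq.idem iq_eq.invol iq_eq.distrib)
qed


section \<open>Link diagrams\<close>

text \<open>
  A link diagram on the sphere is given by a planar diagram code.  The diagram is cut into edges,
  which carry labels, at its crossings and at auxiliary points of degree two.
  \<open>Crossing a b c d\<close> is a crossing whose incident edges are \<open>a, b, c, d\<close> in counterclockwise order,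
  where \<open>a, c\<close> belong to the under-strand and \<open>b, d\<close> to the over-strand.  \<open>Joint a b\<close> is a point
  in the interior of a strand at which the edges \<open>a\<close> and \<open>b\<close> meet; a component without
  crossings is \<open>Joint a a\<close>, up to subdivision.

  The relative position of the connected components of a split diagram is not recorded: it does not
  influence the link up to isotopy.
\<close>

datatype vertex = Crossing nat nat nat nat | Joint nat nat

type_synonym diagram = "vertex list"

fun ends :: "vertex \<Rightarrow> nat list" where
  "ends (Crossing a b c d) = [a, b, c, d]"
| "ends (Joint a b) = [a, b]"

fun is_crossing :: "vertex \<Rightarrow> bool" where
  "is_crossing (Crossing a b c d) = True"
| "is_crossing (Joint a b) = False"

fun relabel :: "(nat \<Rightarrow> nat) \<Rightarrow> vertex \<Rightarrow> vertex" where
  "relabel f (Crossing a b c d) = Crossing (f a) (f b) (f c) (f d)"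
| "relabel f (Joint a b) = Joint (f a) (f b)"

definition all_ends :: "diagram \<Rightarrow> nat list" where
  "all_ends D = concat (map ends D)"

definition edges :: "diagram \<Rightarrow> nat set" where
  "edges D = set (all_ends D)"

definition eq_closure :: "('a \<times> 'a) set \<Rightarrow> ('a \<times> 'a) set" where
  "eq_closure r = (r \<union> r\<inverse>)\<^sup>*"

text \<open>
  The dart \<open>(i, s)\<close> is the \<open>s\<close>-th edge end at the \<open>i\<close>-th vertex.
\<close>

definition darts :: "diagram \<Rightarrow> (nat \<times> nat) set" where
  "darts D = {(i, s). i < length D \<and> s < length (ends (D ! i))}"

definition label :: "diagram \<Rightarrow> nat \<times> nat \<Rightarrow> nat" where
  "label D d = ends (D ! fst d) ! snd d"

definition opposite :: "diagram \<Rightarrow> nat \<times> nat \<Rightarrow> nat \<times> nat" where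
  "opposite D d = (THE d'. d' \<in> darts D \<and> d' \<noteq> d \<and> label D d' = label D d)"

definition rotate_dart :: "diagram \<Rightarrow> nat \<times> nat \<Rightarrow> nat \<times> nat" where
  "rotate_dart D d = (fst d, Suc (snd d) mod length (ends (D ! fst d)))"

text \<open>
  A dart also stands for a side of its edge; walking along a face, one traverses an edge and
  continues with the next edge in the rotation at the vertex reached.
\<close>

definition faces :: "diagram \<Rightarrow> (nat \<times> nat) set set" where
  "faces D = darts D // eq_closure {(d, rotate_dart D (opposite D d)) | d. d \<in> darts D}"

definition components :: "diagram \<Rightarrow> (nat \<times> nat) set set" where
  "components D = darts D //
     eq_closure ({(d, opposite D d) | d. d \<in> darts D} \<union> {(d, rotate_dart D d) | d. d \<in> darts D})"

text \<open>
  Every connected component \<open>C\<close> of the rotation system satisfies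
  \<open>V C - E C + F C \<le> 2\<close>, with equality iff it embeds in the sphere; so summing up, the
  following equation says that all connected components are planar.
\<close>

definition planar :: "diagram \<Rightarrow> bool" where
  "planar D \<longleftrightarrow> length D + card (faces D) = card (edges D) + 2 * card (components D)"

definition link_diagram :: "diagram \<Rightarrow> bool" where
  "link_diagram D \<longleftrightarrow>
     D \<noteq> [] \<and> (\<forall>e\<in>edges D. count_list (all_ends D) e = 2) \<and> planar D"


section \<open>Reidemeister moves and links\<close>

text \<open>
  The first five rules identify descriptions of the same diagram.  In \<open>R1\<close> to \<open>R3\<close> all edges that
  occur on one side only are interior to the disc in which the move takes place.  In \<open>R2\<close> the
  strand \<open>p, q, r\<close> passes over \<open>s, t, u\<close>.  In \<open>R3\<close> the strand \<open>t\<close> lies over \<open>m\<close>, which lies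
  over \<open>b\<close>; the two versions differ by a reflection of the plane.
\<close>

inductive move :: "diagram \<Rightarrow> diagram \<Rightarrow> bool" where
  permute: "mset D = mset D' \<Longrightarrow> move D D'"
| rename: "inj_on f (edges D) \<Longrightarrow> move D (map (relabel f) D)"
| turn_crossing: "move (Crossing a b c d # D) (Crossing c d a b # D)"
| turn_joint: "move (Joint a b # D) (Joint b a # D)"
| remove_joint: "a \<noteq> b \<Longrightarrow> move (Joint a b # D) (map (relabel (id(b := a))) D)"
| R1: "move (Crossing k k a b # D) (Joint a b # D)"
| R1': "move (Crossing a k k b # D) (Joint a b # D)"
| R2: "move (Crossing s q t p # Crossing t q u r # D) (Joint p r # Joint s u # D)"
| R3: "move (Crossing b1 m1 b2 m2 # Crossing b2 t1 b3 t2 # Crossing m2 t2 m3 t3 # D)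
            (Crossing b1 t2 b2 t3 # Crossing m1 t1 m2 t2 # Crossing b2 m2 b3 m3 # D)"
| R3': "move (Crossing b1 m2 b2 m1 # Crossing b2 t2 b3 t1 # Crossing m2 t3 m3 t2 # D)
             (Crossing b1 t3 b2 t2 # Crossing m1 t2 m2 t1 # Crossing b2 m3 b3 m2 # D)"

text \<open>
  Both ends of a move must be planar; for \<open>R2\<close> read from right to left this expresses that
  the two strands are adjacent to a common face, on the appropriate sides.
\<close>

definition link_equiv :: "(diagram \<times> diagram) set" where
  "link_equiv = {(D, D'). link_diagram D \<and>
     (D, D') \<in> eq_closure {(D, D'). link_diagram D \<and> link_diagram D' \<and> move D D'}}"

lemma equiv_link_equiv: "equiv {D. link_diagram D} link_equiv"
proof -
  define r where "r = {(D, D'). link_diagram D \<and> link_diagram D' \<and> move D D'}"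
  have sy: "sym ((r \<union> r\<inverse>)\<^sup>*)"
    by (simp add: sym_Un_converse sym_rtrancl)
  have cl: "link_diagram D'" if "(D, D') \<in> (r \<union> r\<inverse>)\<^sup>*" "link_diagram D" for D D'
    using that by (induction rule: rtrancl_induct) (auto simp: r_def)
  have eq: "link_equiv = {(D, D'). link_diagram D \<and> (D, D') \<in> (r \<union> r\<inverse>)\<^sup>*}"
    unfolding link_equiv_def eq_closure_def r_def ..
  show ?thesis
    unfolding eq
    by (rule equivI) (auto simp: refl_on_def intro!: symI transI intro: cl symD[OF sy] rtrancl_trans)
qed

text \<open>
  By Reidemeister's theorem, the isotopy classes of (tame, unoriented) links in the 3-sphere are
  the classes of link diagrams under the moves; a link is identified with the set of its diagrams.
\<close>

definition links :: "diagram set set" where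
  "links = {D. link_diagram D} // link_equiv"

definition unlink :: "diagram set \<Rightarrow> bool" where
  "unlink L \<longleftrightarrow> (\<exists>D\<in>L. \<forall>v\<in>set D. \<not> is_crossing v)"


section \<open>Alternating links\<close>

text \<open>
  Edges that are related by \<open>segment_rel\<close> form the part of a link component between two
  consecutive passages through crossings.  Alternation means that of these two passages, one is an
  over-passage (odd second coordinate of the dart) and one is an under-passage.
\<close>

definition segment_rel :: "diagram \<Rightarrow> (nat \<times> nat) set" where
  "segment_rel D = eq_closure {(a, b). Joint a b \<in> set D}"

definition crossing_darts :: "diagram \<Rightarrow> (nat \<times> nat) set" where
  "crossing_darts D = {d \<in> darts D. is_crossing (D ! fst d)}"

definition alternating_diagram :: "diagram \<Rightarrow> bool" where
  "alternating_diagram D \<longleftrightarrow>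
     (\<forall>d\<in>crossing_darts D. \<forall>d'\<in>crossing_darts D.
        d \<noteq> d' \<and> (label D d, label D d') \<in> segment_rel D \<longrightarrow> odd (snd d) \<noteq> odd (snd d'))"

definition alternating_link :: "diagram set \<Rightarrow> bool" where
  "alternating_link L \<longleftrightarrow> (\<exists>D\<in>L. alternating_diagram D)"


section \<open>The involutory quandle of a link diagram\<close>

definition arc_rel :: "diagram \<Rightarrow> (nat \<times> nat) set" where
  "arc_rel D = eq_closure
     ({(a, b). Joint a b \<in> set D} \<union> {(b, d). \<exists>a c. Crossing a b c d \<in> set D})"

definition arc :: "diagram \<Rightarrow> nat \<Rightarrow> nat set" where
  "arc D e = arc_rel D `` {e}"

definition arcs :: "diagram \<Rightarrow> nat set set" where
  "arcs D = arc D ` edges D"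

definition IQ :: "diagram \<Rightarrow> nat set qterm set magma" where
  "IQ D = presented_iq (arcs D)
     {(Gen (arc D c), Op (Gen (arc D a)) (Gen (arc D b))) | a b c d. Crossing a b c d \<in> set D}"

end

theory Submission
  imports Defs "HOL-Library.Function_Algebras" "HOL-Combinatorics.List_Permutation"
begin

text \<open>
  In a left-ordered involutory quandle, \<open>x < y\<close> implies \<open>y < x * y\<close>
  (\<open>left_order_between\<close>): at a crossing the color of the over-arc lies strictly between the colors
  of the two under-arcs, unless all three agree.  In an alternating diagram whose joints have been
  removed, every edge at a crossing runs from an over-passage to an under-passage, so the edges turn the crossings
  into a digraph with two edges out of and two edges into each vertex.  On such a digraph betweenness
  is a maximum principle, and the colors are constant along edges
  (\<open>constant_on_edges_if_between\<close>).

  Now suppose that \<open>IQ(L)\<close> is left-ordered.  Its coloring of a diagram is universal, and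
  universality survives Reidemeister moves because the colorings of the two sides of a move correspond
  to each other, naturally in the quandle (\<open>universal_coloring_move\<close>).  So an alternating diagram of
  \<open>L\<close> has a universal coloring in a left-ordered quandle, which is constant along edges; hence every
  coloring of this diagram by any involutory quandle is constant along edges.  Take for this quandle
  the core of the abelian group generated by the crossings in which, for every crossing \<open>c\<close> with
  predecessors \<open>p\<close> and \<open>q\<close>, one has \<open>p + q = 2 c\<close>.  That the coloring by generators is constant says
  that the torsion of this group is trivial, that is, every connected piece of the diagram has
  determinant 1.  It is classical that all crossings of such an alternating diagram are nugatory.
  Here a direct argument finds a kink: triviality of the group gives, for each edge, an integer
  function on the crossings whose Laplacian is the difference of the two endpoints, and one of its
  upper level sets contains the target but not the source of the edge and is left by just one edge
  (\<open>one_edge_cut_if_integer_potential\<close>).  A smallest set that is left by just one edge can, by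
  submodularity of cuts, only be a vertex with a loop (\<open>loop_if_one_edge_cuts\<close>), and a loop of the
  digraph is a kink of the diagram (\<open>kink_exists\<close>).

  Removing a kink by the first Reidemeister move, and removing joints, preserves planarity and
  alternation.  By induction \<open>L\<close> has a diagram without crossings (\<open>alternating_simplifies\<close>), so it is
  an unlink.
\<close>

section \<open>Digraphs with two edges into and two edges out of every vertex\<close>

text \<open>
  The crossings of an alternating diagram, with edges directed from over-passage to under-passage,
  form such a digraph; loops and parallel edges occur.
\<close>

locale two_in_two_out =
  fixes V :: "'v set" and E :: "'e set" and src tgt :: "'e \<Rightarrow> 'v"
  assumes finite_V: "finite V" and finite_E: "finite E"
    and src_V: "e \<in> E \<Longrightarrow> src e \<in> V" and tgt_V: "e \<in> E \<Longrightarrow> tgt e \<in> V"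
    and out_degree: "v \<in> V \<Longrightarrow> card {e \<in> E. src e = v} = 2"
    and in_degree: "v \<in> V \<Longrightarrow> card {e \<in> E. tgt e = v} = 2"
begin

definition out_cut :: "'v set \<Rightarrow> 'e set" where
  "out_cut S = {e \<in> E. src e \<in> S \<and> tgt e \<notin> S}"

definition in_cut :: "'v set \<Rightarrow> 'e set" where
  "in_cut S = {e \<in> E. src e \<notin> S \<and> tgt e \<in> S}"

lemma finite_out_cut: "finite (out_cut S)"
  and finite_in_cut: "finite (in_cut S)"
  using finite_E by (simp_all add: out_cut_def in_cut_def)

lemma sum_over_sources:
  fixes u :: "'v \<Rightarrow> int"
  assumes "S \<subseteq> V"
  shows "(\<Sum>e\<in>{e \<in> E. src e \<in> S}. u (src e)) = 2 * (\<Sum>v\<in>S. u v)"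
proof -
  have fS: "finite S" using assms finite_V by (rule finite_subset)
  have "(\<Sum>e\<in>{e \<in> E. src e \<in> S}. u (src e)) =
      (\<Sum>v\<in>S. \<Sum>e\<in>{e \<in> {e \<in> E. src e \<in> S}. src e = v}. u (src e))"
    by (rule sum.group[symmetric]) (use finite_E fS in auto)
  also have "\<dots> = (\<Sum>v\<in>S. 2 * u v)"
  proof (rule sum.cong[OF HOL.refl])
    fix v assume v: "v \<in> S"
    then have "{e \<in> {e \<in> E. src e \<in> S}. src e = v} = {e \<in> E. src e = v}" by auto
    then show "(\<Sum>e\<in>{e \<in> {e \<in> E. src e \<in> S}. src e = v}. u (src e)) = 2 * u v"
      using out_degree[of v] v assms by auto
  qed
  finally show ?thesis by (simp add: sum_distrib_left)
qed

lemma sum_over_targets: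
  fixes u :: "'v \<Rightarrow> int"
  assumes "S \<subseteq> V"
  shows "(\<Sum>e\<in>{e \<in> E. tgt e \<in> S}. u (tgt e)) = 2 * (\<Sum>v\<in>S. u v)"
proof -
  interpret rev: two_in_two_out V E tgt src
    by unfold_locales (use finite_V finite_E src_V tgt_V out_degree in_degree in auto)
  show ?thesis using assms by (rule rev.sum_over_sources)
qed

text \<open>
  Both sums of \<open>u\<close> over edges that start in \<open>S\<close> and over edges that end in \<open>S\<close>, evaluated at the
  endpoint in \<open>S\<close>, are \<open>2 * sum u S\<close>.  So the total of the differences along edges starting in \<open>S\<close> is
  determined by the edges that cross the boundary of \<open>S\<close>.
\<close>

lemma sum_differences_across_cut:
  fixes u :: "'v \<Rightarrow> int"
  assumes "S \<subseteq> V"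
  shows "(\<Sum>e\<in>{e \<in> E. src e \<in> S}. u (tgt e) - u (src e)) =
    (\<Sum>e\<in>out_cut S. u (tgt e)) - (\<Sum>e\<in>in_cut S. u (tgt e))"
proof -
  let ?I = "{e \<in> E. src e \<in> S \<and> tgt e \<in> S}"
  have "(\<Sum>e\<in>{e \<in> E. src e \<in> S}. u (tgt e)) = (\<Sum>e\<in>?I \<union> out_cut S. u (tgt e))"
    by (rule sum.cong) (auto simp: out_cut_def)
  also have "\<dots> = (\<Sum>e\<in>?I. u (tgt e)) + (\<Sum>e\<in>out_cut S. u (tgt e))"
    by (rule sum.union_disjoint) (use finite_E in \<open>auto simp: out_cut_def\<close>)
  finally have 1: "(\<Sum>e\<in>{e \<in> E. src e \<in> S}. u (tgt e)) =
      (\<Sum>e\<in>?I. u (tgt e)) + (\<Sum>e\<in>out_cut S. u (tgt e))" .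
  have "(\<Sum>e\<in>{e \<in> E. tgt e \<in> S}. u (tgt e)) = (\<Sum>e\<in>?I \<union> in_cut S. u (tgt e))"
    by (rule sum.cong) (auto simp: in_cut_def)
  also have "\<dots> = (\<Sum>e\<in>?I. u (tgt e)) + (\<Sum>e\<in>in_cut S. u (tgt e))"
    by (rule sum.union_disjoint) (use finite_E in \<open>auto simp: in_cut_def\<close>)
  finally have 2: "(\<Sum>e\<in>{e \<in> E. tgt e \<in> S}. u (tgt e)) =
      (\<Sum>e\<in>?I. u (tgt e)) + (\<Sum>e\<in>in_cut S. u (tgt e))" .
  show ?thesis
    using 1 2 sum_over_sources[OF assms, of u] sum_over_targets[OF assms, of u]
    by (simp add: sum_subtractf)
qed

lemma card_out_cut_eq_in_cut:
  assumes "S \<subseteq> V"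
  shows "card (out_cut S) = card (in_cut S)"
  using sum_differences_across_cut[OF assms, of "\<lambda>_. 1"] by simp

text \<open>
  A maximum principle.  Among the edges on which \<open>\<phi>\<close> is not constant, take one whose target value \<open>m\<close>
  is maximal.  No edge enters the set where \<open>\<phi>\<close> exceeds \<open>m\<close>, hence none leaves it either; but
  betweenness at the target provides an edge that does.
\<close>

lemma constant_on_edges_if_between:
  assumes lt: "irreflp_on A lt" "transp_on A lt" "totalp_on A lt"
    and \<phi>: "\<And>v. v \<in> V \<Longrightarrow> \<phi> v \<in> A"
    and between: "\<And>e. e \<in> E \<Longrightarrow> lt (\<phi> (src e)) (\<phi> (tgt e)) \<Longrightarrow>
      \<exists>e'\<in>E. tgt e' = tgt e \<and> lt (\<phi> (tgt e)) (\<phi> (src e'))"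
    and e: "e \<in> E"
  shows "\<phi> (src e) = \<phi> (tgt e)"
proof (rule ccontr)
  assume ne: "\<phi> (src e) \<noteq> \<phi> (tgt e)"
  define N where "N = \<phi> ` tgt ` {e \<in> E. \<phi> (src e) \<noteq> \<phi> (tgt e)}"
  have N: "finite N" "N \<noteq> {}" "N \<subseteq> A"
    using finite_E e ne \<phi> tgt_V by (auto simp: N_def)
  have as: "asymp_on N lt"
  proof (rule asymp_onI)
    fix x y assume xy: "x \<in> N" "y \<in> N" "lt x y"
    then have A: "x \<in> A" "y \<in> A" using N(3) by auto
    show "\<not> lt y x"
      using transp_onD[OF lt(2) A(1,2,1) xy(3)] irreflp_onD[OF lt(1) A(1)] by blast
  qed
  have "\<exists>m\<in>N. \<forall>x\<in>N. x \<noteq> m \<longrightarrow> \<not> lt m x"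
    using N as transp_on_subset[OF lt(2) N(3)] by (intro Finite_Set.bex_max_element)
  then obtain m where m: "m \<in> N" "\<And>x. x \<in> N \<Longrightarrow> \<not> lt m x"
    using as unfolding asymp_on_def by metis
  then obtain e0 where e0: "e0 \<in> E" "\<phi> (src e0) \<noteq> \<phi> (tgt e0)" "m = \<phi> (tgt e0)"
    by (auto simp: N_def)
  \<comment> \<open>If the other end of \<open>e0\<close> is below \<open>m\<close>, betweenness yields an edge from above; otherwise \<open>e0\<close> itself
    comes from above.\<close>
  obtain e1 where e1: "e1 \<in> E" "tgt e1 = tgt e0" "lt m (\<phi> (src e1))"
    using between[OF e0(1)] e0 lt(3) \<phi> src_V tgt_V unfolding totalp_on_def by metis
  define U where "U = {v \<in> V. lt m (\<phi> v)}"
  have "in_cut U = {}"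
  proof -
    have False if "e' \<in> E" "src e' \<notin> U" "tgt e' \<in> U" for e'
    proof -
      have "\<phi> (src e') \<noteq> \<phi> (tgt e')" using that src_V by (auto simp: U_def)
      then have "\<phi> (tgt e') \<in> N" using that by (auto simp: N_def)
      then show False using m(2) that by (auto simp: U_def)
    qed
    then show ?thesis by (auto simp: in_cut_def)
  qed
  then have "out_cut U = {}"
    using card_out_cut_eq_in_cut[of U] finite_out_cut by (simp add: U_def)
  moreover have "e1 \<in> out_cut U"
    using e0 e1 m src_V by (auto simp: out_cut_def U_def)
  ultimately show False by blast
qed

text \<open>
  An integer combination of the relators \<open>p + q - 2 c\<close>, written as a function of the vertex \<open>x\<close>, is
  the Laplacian of its coefficient function \<open>w\<close>.
\<close>

lemma relation_as_laplacian:
  fixes w :: "'v \<Rightarrow> int"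
  assumes "x \<in> V"
  shows "(\<Sum>e\<in>E. w (tgt e) * (of_bool (src e = x) - of_bool (tgt e = x))) =
    (\<Sum>e\<in>{e \<in> E. src e = x}. w (tgt e) - w x)"
proof -
  have "(\<Sum>e\<in>E. w (tgt e) * (of_bool (src e = x) - of_bool (tgt e = x))) =
      (\<Sum>e\<in>E. if src e = x then w (tgt e) else 0) - (\<Sum>e\<in>E. if tgt e = x then w (tgt e) else 0)"
    unfolding sum_subtractf[symmetric] by (rule sum.cong) auto
  also have "(\<Sum>e\<in>E. if src e = x then w (tgt e) else 0) = (\<Sum>e\<in>{e \<in> E. src e = x}. w (tgt e))"
    by (rule sum.inter_filter[OF finite_E, symmetric])
  also have "(\<Sum>e\<in>E. if tgt e = x then w (tgt e) else 0) = (\<Sum>e\<in>{e \<in> E. tgt e = x}. w (tgt e))"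
    by (rule sum.inter_filter[OF finite_E, symmetric])
  also have "\<dots> = (\<Sum>e\<in>{e \<in> E. tgt e = x}. w x)" by (rule sum.cong) auto
  also have "\<dots> = (\<Sum>e\<in>{e \<in> E. src e = x}. w x)"
    using in_degree[OF assms] out_degree[OF assms] by simp
  finally show ?thesis by (simp add: sum_subtractf)
qed

text \<open>
  The Laplacian of \<open>u\<close> sums to 1, 0 or -1 over any set of vertices.  Across an upper level set, integer
  values drop by at least 1 along each outgoing edge, so at most one edge leaves it, and one leaves it
  exactly if it contains the target of \<open>e\<close> but not the source.
\<close>

lemma one_edge_cut_if_integer_potential:
  fixes u :: "'v \<Rightarrow> int"
  assumes e: "e \<in> E" "src e \<noteq> tgt e"
    and u: "\<And>x. x \<in> V \<Longrightarrow> (\<Sum>e'\<in>{e' \<in> E. src e' = x}. u (tgt e') - u x) =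
      of_bool (x = src e) - of_bool (x = tgt e)"
  shows "\<exists>S\<subseteq>V. card (out_cut S) = 1 \<and> src e \<notin> S \<and> tgt e \<in> S"
proof -
  define S where "S t = {x \<in> V. t \<le> u x}" for t
  have SV: "S t \<subseteq> V" for t by (auto simp: S_def)
  have finS: "finite (S t)" for t using SV finite_V by (rule finite_subset)
  \<comment> \<open>The right-hand side is minus the sum of the Laplacian over the level set.\<close>
  have flow: "int (card (out_cut (S t))) \<le> of_bool (tgt e \<in> S t) - of_bool (src e \<in> S t)" for t
  proof -
    have "(\<Sum>e'\<in>{e' \<in> E. src e' \<in> S t}. u (tgt e') - u (src e')) =
        (\<Sum>x\<in>S t. \<Sum>e'\<in>{e' \<in> {e' \<in> E. src e' \<in> S t}. src e' = x}. u (tgt e') - u (src e'))"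
      by (rule sum.group[symmetric]) (use finite_E finS in auto)
    also have "\<dots> = (\<Sum>x\<in>S t. of_bool (x = src e) - of_bool (x = tgt e))"
    proof (rule sum.cong[OF HOL.refl])
      fix x assume x: "x \<in> S t"
      have "(\<Sum>e'\<in>{e' \<in> {e' \<in> E. src e' \<in> S t}. src e' = x}. u (tgt e') - u (src e')) =
          (\<Sum>e'\<in>{e' \<in> E. src e' = x}. u (tgt e') - u x)"
        by (rule sum.cong) (use x in auto)
      also have "\<dots> = of_bool (x = src e) - of_bool (x = tgt e)"
        using x SV by (intro u) auto
      finally show "(\<Sum>e'\<in>{e' \<in> {e' \<in> E. src e' \<in> S t}. src e' = x}. u (tgt e') - u (src e')) =
          of_bool (x = src e) - of_bool (x = tgt e)" .
    qed
    also have "\<dots> = of_bool (src e \<in> S t) - of_bool (tgt e \<in> S t)"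
      using finS by (simp add: sum_subtractf of_bool_def sum.delta)
    finally have eq: "(\<Sum>e'\<in>out_cut (S t). u (tgt e')) - (\<Sum>e'\<in>in_cut (S t). u (tgt e')) =
        of_bool (src e \<in> S t) - of_bool (tgt e \<in> S t)"
      using sum_differences_across_cut[OF SV] by simp
    have "(\<Sum>e'\<in>out_cut (S t). u (tgt e')) \<le> (\<Sum>e'\<in>out_cut (S t). t - 1)"
      by (rule sum_mono) (auto simp: out_cut_def S_def tgt_V)
    moreover have "(\<Sum>e'\<in>in_cut (S t). t) \<le> (\<Sum>e'\<in>in_cut (S t). u (tgt e'))"
      by (rule sum_mono) (auto simp: in_cut_def S_def)
    ultimately show ?thesis
      using eq card_out_cut_eq_in_cut[OF SV, of t] by (simp add: algebra_simps)
  qed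
  \<comment> \<open>Otherwise the flow at level \<open>u (src e)\<close> forces equality, so no level set separates the ends of \<open>e\<close>
    and no edge crosses the boundary of any of them; then the Laplacian of \<open>u\<close> would vanish.\<close>
  have "u (src e) < u (tgt e)"
  proof (rule ccontr)
    assume "\<not> u (src e) < u (tgt e)"
    moreover have "tgt e \<in> S (u (src e))"
      using flow[of "u (src e)"] e src_V by (auto simp: S_def of_bool_def split: if_splits)
    ultimately have ueq: "u (src e) = u (tgt e)" by (simp add: S_def)
    have no_cut: "out_cut (S t) = {}" "in_cut (S t) = {}" for t
    proof -
      have "src e \<in> S t \<longleftrightarrow> tgt e \<in> S t" using ueq e src_V tgt_V by (simp add: S_def)
      then have "card (out_cut (S t)) = 0" using flow[of t] by simp
      then show "out_cut (S t) = {}" "in_cut (S t) = {}"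
        using card_out_cut_eq_in_cut[OF SV, of t] finite_out_cut finite_in_cut by simp_all
    qed
    have const: "u (tgt e') = u (src e')" if "e' \<in> E" for e'
    proof (rule antisym)
      show "u (tgt e') \<le> u (src e')"
        using no_cut(2)[of "u (tgt e')"] that src_V tgt_V by (force simp: in_cut_def S_def)
      show "u (src e') \<le> u (tgt e')"
        using no_cut(1)[of "u (src e')"] that src_V tgt_V by (force simp: out_cut_def S_def)
    qed
    have "(\<Sum>e'\<in>{e' \<in> E. src e' = src e}. u (tgt e') - u (src e)) = 0"
      by (rule sum.neutral) (use const in auto)
    then show False using u[of "src e"] e src_V by simp
  qed
  then have "src e \<notin> S (u (src e) + 1)" "tgt e \<in> S (u (src e) + 1)"
    using e tgt_V by (auto simp: S_def)
  moreover from this have "in_cut (S (u (src e) + 1)) \<noteq> {}" using e by (auto simp: in_cut_def)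
  ultimately have "card (out_cut (S (u (src e) + 1))) = 1"
    using flow[of "u (src e) + 1"] card_out_cut_eq_in_cut[OF SV, of "u (src e) + 1"]
      finite_in_cut[of "S (u (src e) + 1)"] card_gt_0_iff[of "in_cut (S (u (src e) + 1))"] by simp
  then show ?thesis
    using \<open>src e \<notin> _\<close> \<open>tgt e \<in> _\<close> SV by blast
qed

text \<open>
  Without loops, a vertex set \<open>S\<close> of minimal cardinality among those left by one edge contains both ends
  of some edge \<open>e\<close>, as each vertex of \<open>S\<close> has two outgoing edges.  The set \<open>T\<close> separating the ends of \<open>e\<close>
  is uncrossed with \<open>S\<close>: minimality makes both \<open>S \<inter> T\<close> and \<open>S - T\<close> be left by at least two edges, so by
  submodularity no edge leaves \<open>S \<union> T\<close> or \<open>S \<union> (V - T)\<close>, and then none leaves \<open>S\<close>.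
\<close>

lemma loop_if_one_edge_cuts:
  assumes "V \<noteq> {}"
    and sep: "\<And>e. e \<in> E \<Longrightarrow> src e \<noteq> tgt e \<Longrightarrow>
      \<exists>S\<subseteq>V. card (out_cut S) = 1 \<and> src e \<notin> S \<and> tgt e \<in> S"
  shows "\<exists>e\<in>E. src e = tgt e"
proof (rule ccontr)
  assume no_loop: "\<not> (\<exists>e\<in>E. src e = tgt e)"
  define one where "one S \<longleftrightarrow> S \<subseteq> V \<and> card (out_cut S) = 1" for S
  have edge_from: "\<exists>e\<in>E. src e = v \<and> e \<notin> X" if "v \<in> V" "card X \<le> 1" "finite X" for v X
  proof (rule ccontr)
    assume "\<not> ?thesis"
    then have "{e \<in> E. src e = v} \<subseteq> X" by auto
    then have "2 \<le> card X" using card_mono[OF that(3)] out_degree[OF that(1)] by metis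
    then show False using that by simp
  qed
  obtain v where "v \<in> V" using assms by blast
  then obtain e where "e \<in> E" using edge_from[of v "{}"] by auto
  then have "\<exists>S. one S" using sep no_loop unfolding one_def by blast
  then obtain S where S: "one S" and minS: "\<And>T. one T \<Longrightarrow> card S \<le> card T"
    using ex_has_least_nat[of one _ card] by metis
  have SV: "S \<subseteq> V" and cS: "card (out_cut S) = 1" using S by (auto simp: one_def)
  have finS: "finite S" using SV finite_V by (rule finite_subset)
  obtain x where x: "out_cut S = {x}" using cS card_1_singletonE by blast
  have "src x \<in> S" "src x \<in> V" using x SV by (auto simp: out_cut_def)
  then obtain e where e: "e \<in> E" "src e \<in> S" "e \<notin> out_cut S"
    using edge_from[of "src x" "out_cut S"] x by auto
  then have te: "tgt e \<in> S" by (auto simp: out_cut_def)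
  obtain T where T: "T \<subseteq> V" "card (out_cut T) = 1" "src e \<notin> T" "tgt e \<in> T"
    using sep[OF e(1)] no_loop e by blast
  define T' where "T' = V - T"
  have T': "T' \<subseteq> V" "card (out_cut T') = 1"
  proof -
    have "out_cut T' = in_cut T" using src_V tgt_V by (auto simp: T'_def out_cut_def in_cut_def)
    then show "T' \<subseteq> V" "card (out_cut T') = 1"
      using T card_out_cut_eq_in_cut[OF T(1)] by (auto simp: T'_def)
  qed
  have submodular: "card (out_cut (S \<inter> X)) + card (out_cut (S \<union> X)) \<le> card (out_cut S) + card (out_cut X)" for X
  proof -
    have "card (out_cut (S \<inter> X)) + card (out_cut (S \<union> X)) =
        card (out_cut (S \<inter> X) \<union> out_cut (S \<union> X)) + card (out_cut (S \<inter> X) \<inter> out_cut (S \<union> X))"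
      by (rule card_Un_Int) (rule finite_out_cut)+
    also have "\<dots> \<le> card (out_cut S \<union> out_cut X) + card (out_cut S \<inter> out_cut X)"
      by (intro add_mono card_mono) (auto simp: finite_out_cut, auto simp: out_cut_def)
    also have "\<dots> = card (out_cut S) + card (out_cut X)"
      by (rule card_Un_Int[symmetric]) (rule finite_out_cut)+
    finally show ?thesis .
  qed
  have closed: "out_cut (S \<union> X) = {}"
    if X: "card (out_cut X) = 1" "S \<inter> X \<subset> S" "out_cut (S \<inter> X) \<noteq> {}" for X
  proof -
    have "card (S \<inter> X) < card S" using X(2) finS by (simp add: psubset_card_mono)
    then have "card (out_cut (S \<inter> X)) \<noteq> 1" using minS[of "S \<inter> X"] SV by (auto simp: one_def)
    moreover have "card (out_cut (S \<inter> X)) \<noteq> 0" using X(3) finite_out_cut by simp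
    ultimately have "card (out_cut (S \<union> X)) = 0" using submodular[of X] X(1) cS by linarith
    then show ?thesis using finite_out_cut by simp
  qed
  have "out_cut (S \<inter> T) \<noteq> {}"
  proof -
    have "e \<in> in_cut (S \<inter> T)" using e te T by (auto simp: in_cut_def)
    then show ?thesis
      using card_out_cut_eq_in_cut[of "S \<inter> T"] SV finite_in_cut[of "S \<inter> T"]
      by (metis card_eq_0_iff empty_iff finite_out_cut le_infI1)
  qed
  moreover have "S \<inter> T \<subset> S" using e T by auto
  ultimately have cl: "out_cut (S \<union> T) = {}" using T closed by blast
  have "e \<in> out_cut (S \<inter> T')" using e te T SV by (auto simp: out_cut_def T'_def)
  moreover have "S \<inter> T' \<subset> S" using te T by (auto simp: T'_def)
  ultimately have cl': "out_cut (S \<union> T') = {}" using T' closed by blast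
  have "x \<in> E" "src x \<in> S" "tgt x \<notin> S" using x by (auto simp: out_cut_def)
  then show False using cl cl' tgt_V by (auto simp: out_cut_def T'_def)
qed

end

section \<open>Left-ordered quandles and cores of abelian groups\<close>

lemma star_closed:
  assumes "involutory_quandle Q" "x \<in> elems Q" "y \<in> elems Q"
  shows "x \<star>\<^bsub>Q\<^esub> y \<in> elems Q"
  using assms unfolding involutory_quandle_def quandle_def by blast

lemma star_idem:
  assumes "involutory_quandle Q" "x \<in> elems Q"
  shows "x \<star>\<^bsub>Q\<^esub> x = x"
  using assms unfolding involutory_quandle_def quandle_def by blast

lemma star_invol:
  assumes "involutory_quandle Q" "x \<in> elems Q" "y \<in> elems Q"
  shows "(x \<star>\<^bsub>Q\<^esub> y) \<star>\<^bsub>Q\<^esub> y = x"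
  using assms unfolding involutory_quandle_def by blast

lemma star_distrib:
  assumes "involutory_quandle Q" "x \<in> elems Q" "y \<in> elems Q" "z \<in> elems Q"
  shows "(x \<star>\<^bsub>Q\<^esub> y) \<star>\<^bsub>Q\<^esub> z = (x \<star>\<^bsub>Q\<^esub> z) \<star>\<^bsub>Q\<^esub> (y \<star>\<^bsub>Q\<^esub> z)"
  using assms unfolding involutory_quandle_def quandle_def by blast

text \<open>
  Left multiplication by \<open>x\<close> gives \<open>x < x * y\<close>.  If \<open>z = x * y\<close> were below \<open>y\<close>, left multiplication by
  \<open>z\<close> would give \<open>z < z * y = x\<close>.
\<close>

lemma left_order_between:
  assumes Q: "involutory_quandle Q" and lt: "left_order_on Q lt"
    and x: "x \<in> elems Q" "y \<in> elems Q" and less: "lt x y"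
  shows "lt y (x \<star>\<^bsub>Q\<^esub> y)"
proof (rule ccontr)
  let ?z = "x \<star>\<^bsub>Q\<^esub> y"
  have z: "?z \<in> elems Q" using Q x by (rule star_closed)
  have irr: "\<not> lt a a" if "a \<in> elems Q" for a
    using lt that unfolding left_order_on_def irreflp_on_def by blast
  have mono: "lt (c \<star>\<^bsub>Q\<^esub> a) (c \<star>\<^bsub>Q\<^esub> b)"
    if "a \<in> elems Q" "b \<in> elems Q" "c \<in> elems Q" "lt a b" for a b c
    using lt that unfolding left_order_on_def by blast
  have xz: "lt x ?z" using mono[OF x(1,2,1) less] star_idem[OF Q x(1)] by simp
  assume "\<not> lt y ?z"
  then consider "lt ?z y" | "?z = y"
    using lt x z unfolding left_order_on_def totalp_on_def by metis
  then show False
  proof cases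
    case 1
    then have "lt ?z x" using mono[OF z x(2) z 1] star_idem[OF Q z] star_invol[OF Q x] by simp
    then have "lt x x" using lt xz x z unfolding left_order_on_def transp_on_def by metis
    then show False using irr x by blast
  next
    case 2
    then have "x = y" using star_invol[OF Q x] star_idem[OF Q x(2)] by simp
    then show False using irr less x by blast
  qed
qed

definition coset :: "'a::ab_group_add set \<Rightarrow> 'a \<Rightarrow> 'a set" where
  "coset H v = {x. x - v \<in> H}"

text \<open>
  The core quandle \<open>v * w = 2 w - v\<close> of the quotient of an abelian group by the subgroup \<open>H\<close>.
\<close>

definition core_quotient :: "'a::ab_group_add set \<Rightarrow> 'a set magma" where
  "core_quotient H =
     \<lparr> elems = range (coset H), star = (\<lambda>A B. {b + b - a | a b. a \<in> A \<and> b \<in> B}) \<rparr>"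

locale additive_subgroup =
  fixes H :: "'a::ab_group_add set"
  assumes zero_mem: "0 \<in> H" and diff_mem: "x \<in> H \<Longrightarrow> y \<in> H \<Longrightarrow> x - y \<in> H"
begin

lemma minus_mem: "x \<in> H \<Longrightarrow> - x \<in> H"
  using diff_mem[OF zero_mem] by simp

lemma add_mem: "x \<in> H \<Longrightarrow> y \<in> H \<Longrightarrow> x + y \<in> H"
  using diff_mem[OF _ minus_mem] by fastforce

lemma coset_eq_iff: "coset H v = coset H w \<longleftrightarrow> v - w \<in> H"
proof
  assume "coset H v = coset H w"
  moreover have "v \<in> coset H v" by (simp add: coset_def zero_mem)
  ultimately show "v - w \<in> H" by (simp add: coset_def)
next
  assume vw: "v - w \<in> H"
  have "x - w \<in> H" if "x - v \<in> H" for x using add_mem[OF that vw] by simp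
  moreover have "x - v \<in> H" if "x - w \<in> H" for x using diff_mem[OF that vw] by simp
  ultimately show "coset H v = coset H w" by (auto simp: coset_def)
qed

lemma star_coset: "coset H v \<star>\<^bsub>core_quotient H\<^esub> coset H w = coset H (w + w - v)"
proof (intro set_eqI iffI)
  fix x assume "x \<in> coset H v \<star>\<^bsub>core_quotient H\<^esub> coset H w"
  then obtain a b where ab: "x = b + b - a" "a - v \<in> H" "b - w \<in> H"
    by (auto simp: core_quotient_def coset_def)
  have "(b - w) + (b - w) - (a - v) \<in> H" using ab add_mem diff_mem by blast
  moreover have "(b - w) + (b - w) - (a - v) = x - (w + w - v)" by (simp add: ab algebra_simps)
  ultimately show "x \<in> coset H (w + w - v)" by (simp add: coset_def)
next
  fix x assume "x \<in> coset H (w + w - v)"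
  then have "- (x - (w + w - v)) \<in> H" by (intro minus_mem) (simp add: coset_def)
  then have "w + w - x \<in> coset H v" by (simp add: coset_def algebra_simps)
  moreover have "w \<in> coset H w" by (simp add: coset_def zero_mem)
  moreover have "x = w + w - (w + w - x)" by simp
  ultimately have "\<exists>a b. x = b + b - a \<and> a \<in> coset H v \<and> b \<in> coset H w" by blast
  then show "x \<in> coset H v \<star>\<^bsub>core_quotient H\<^esub> coset H w"
    by (simp add: core_quotient_def)
qed

lemma elems_core_quotient: "elems (core_quotient H) = range (coset H)"
  by (simp add: core_quotient_def)

lemma involutory_core_quotient: "involutory_quandle (core_quotient H)"
proof -
  have ex1: "\<exists>!z. z \<in> range (coset H) \<and> z \<star>\<^bsub>core_quotient H\<^esub> coset H w = coset H v" for v w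
  proof (rule ex1I[of _ "coset H (w + w - v)"])
    show "coset H (w + w - v) \<in> range (coset H) \<and>
        coset H (w + w - v) \<star>\<^bsub>core_quotient H\<^esub> coset H w = coset H v"
      by (simp add: star_coset)
  next
    fix z assume "z \<in> range (coset H) \<and> z \<star>\<^bsub>core_quotient H\<^esub> coset H w = coset H v"
    then obtain u where z: "z = coset H u" and "coset H u \<star>\<^bsub>core_quotient H\<^esub> coset H w = coset H v"
      by blast
    then have u: "z = coset H u" "w + w - u - v \<in> H"
      by (simp_all add: star_coset coset_eq_iff)
    then have "u - (w + w - v) \<in> H" using minus_mem[OF u(2)] by (simp add: algebra_simps)
    then show "z = coset H (w + w - v)" by (simp add: u(1) coset_eq_iff)
  qed
  show ?thesis
    unfolding involutory_quandle_def quandle_def elems_core_quotient using ex1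
    by (auto simp: star_coset algebra_simps)
qed

end

section \<open>Colorings and universal colorings\<close>

lemma edges_Nil [simp]: "edges [] = {}"
  by (simp add: edges_def all_ends_def)

lemma edges_Cons [simp]: "edges (v # D) = set (ends v) \<union> edges D"
  by (simp add: edges_def all_ends_def)

lemma ends_relabel: "ends (relabel f v) = map f (ends v)"
  by (cases v) auto

lemma edges_relabel: "edges (map (relabel f) D) = f ` edges D"
  by (induction D) (auto simp: ends_relabel)

lemma all_ends_Cons: "all_ends (v # D) = ends v @ all_ends D"
  by (simp add: all_ends_def)

lemma mem_edges_iff: "e \<in> edges D \<longleftrightarrow> count_list (all_ends D) e \<noteq> 0"
  by (auto simp: edges_def count_list_0_iff)

fun obeys :: "'q magma \<Rightarrow> (nat \<Rightarrow> 'q) \<Rightarrow> vertex \<Rightarrow> bool" where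
  "obeys Q f (Crossing a b c d) \<longleftrightarrow> f b = f d \<and> f c = f a \<star>\<^bsub>Q\<^esub> f b"
| "obeys Q f (Joint a b) \<longleftrightarrow> f a = f b"

definition coloring :: "'q magma \<Rightarrow> diagram \<Rightarrow> (nat \<Rightarrow> 'q) \<Rightarrow> bool" where
  "coloring Q D f \<longleftrightarrow> (\<forall>e\<in>edges D. f e \<in> elems Q) \<and> (\<forall>v\<in>set D. obeys Q f v)"

lemma coloring_Cons:
  "coloring Q (v # D) f \<longleftrightarrow>
    (\<forall>e\<in>set (ends v). f e \<in> elems Q) \<and> obeys Q f v \<and> coloring Q D f"
  by (auto simp: coloring_def)

lemma coloring_cong:
  assumes "\<And>e. e \<in> edges D \<Longrightarrow> f e = g e"
  shows "coloring Q D f \<longleftrightarrow> coloring Q D g"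
  using assms
proof (induction D)
  case (Cons v D)
  then show ?case by (cases v) (auto simp: coloring_Cons)
qed (simp add: coloring_def)

lemma coloring_fun_upd: "k \<notin> edges D \<Longrightarrow> coloring Q D (f(k := x)) \<longleftrightarrow> coloring Q D f"
  by (rule coloring_cong) auto

lemma coloring_relabel: "coloring Q (map (relabel \<rho>) D) f \<longleftrightarrow> coloring Q D (f \<circ> \<rho>)"
proof (induction D)
  case (Cons v D)
  then show ?case by (cases v) (auto simp: coloring_Cons)
qed (simp add: coloring_def)

text \<open>
  The relation \<open>K\<close> identifies edges of \<open>D\<close> with edges of \<open>D'\<close>: those that survive a move.
\<close>

definition lifts :: "(nat \<times> nat) set \<Rightarrow> 'q magma \<Rightarrow> diagram \<Rightarrow> diagram \<Rightarrow> bool" where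
  "lifts K Q D D' \<longleftrightarrow>
     (\<forall>f. coloring Q D f \<longrightarrow> (\<exists>f'. coloring Q D' f' \<and> (\<forall>e e'. (e, e') \<in> K \<longrightarrow> f e = f' e')))"

definition determined :: "nat set \<Rightarrow> 'q magma \<Rightarrow> diagram \<Rightarrow> bool" where
  "determined C Q D \<longleftrightarrow>
     (\<forall>f g. coloring Q D f \<and> coloring Q D g \<and> (\<forall>e\<in>C. f e = g e) \<longrightarrow> (\<forall>e\<in>edges D. f e = g e))"

text \<open>
  Restriction to the edges identified by \<open>K\<close> embeds the colorings of both diagrams in the same set of
  functions, with the same image.
\<close>

definition color_corr :: "(nat \<times> nat) set \<Rightarrow> 'q magma \<Rightarrow> diagram \<Rightarrow> diagram \<Rightarrow> bool" where
  "color_corr K Q D D' \<longleftrightarrow> K \<subseteq> edges D \<times> edges D' \<and>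
     lifts K Q D D' \<and> lifts (K\<inverse>) Q D' D \<and> determined (Domain K) Q D \<and> determined (Range K) Q D'"

lemma color_corr_converse: "color_corr K Q D D' \<Longrightarrow> color_corr (K\<inverse>) Q D' D"
  unfolding color_corr_def by auto

definition magma_hom :: "'q magma \<Rightarrow> 'r magma \<Rightarrow> ('q \<Rightarrow> 'r) \<Rightarrow> bool" where
  "magma_hom Q Q' h \<longleftrightarrow> (\<forall>x\<in>elems Q. h x \<in> elems Q') \<and>
     (\<forall>x\<in>elems Q. \<forall>y\<in>elems Q. h (x \<star>\<^bsub>Q\<^esub> y) = h x \<star>\<^bsub>Q'\<^esub> h y)"

text \<open>
  The test quandles range over one fixed type of elements, which makes this a single predicate.  The type
  is that of cores of quotients of groups of integer functions, the test quandles of interest.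
\<close>

definition universal_coloring :: "'q magma \<Rightarrow> diagram \<Rightarrow> (nat \<Rightarrow> 'q) \<Rightarrow> bool" where
  "universal_coloring Q D f \<longleftrightarrow> coloring Q D f \<and>
     (\<forall>(Q' :: (nat \<Rightarrow> int) set magma) g. involutory_quandle Q' \<and> coloring Q' D g \<longrightarrow>
        (\<exists>h. magma_hom Q Q' h \<and> (\<forall>e\<in>edges D. g e = h (f e))))"

lemma coloring_hom:
  assumes "magma_hom Q Q' h" "coloring Q D f"
  shows "coloring Q' D (h \<circ> f)"
  using assms(2)
proof (induction D)
  case (Cons v D)
  then show ?case using assms(1) by (cases v) (auto simp: coloring_Cons magma_hom_def)
qed (simp add: coloring_def)

text \<open>
  Transport \<open>f\<close> to \<open>f'\<close> on \<open>D'\<close>.  A coloring \<open>g'\<close> of \<open>D'\<close> comes from a coloring \<open>g = h \<circ> f\<close> of \<open>D\<close>, and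
  \<open>h \<circ> f'\<close> agrees with \<open>g'\<close> on the common edges, hence everywhere.
\<close>

lemma universal_coloring_transfer:
  assumes Q: "color_corr K Q D D'"
    and Q': "\<And>Q' :: (nat \<Rightarrow> int) set magma. involutory_quandle Q' \<Longrightarrow> color_corr K Q' D D'"
    and f: "universal_coloring Q D f"
  shows "\<exists>f'. universal_coloring Q D' f'"
proof -
  have "coloring Q D f" "lifts K Q D D'"
    using Q f by (simp_all add: color_corr_def universal_coloring_def)
  then obtain f' where f': "coloring Q D' f'" "\<And>e e'. (e, e') \<in> K \<Longrightarrow> f e = f' e'"
    unfolding lifts_def by blast
  have "\<exists>h. magma_hom Q Q' h \<and> (\<forall>e\<in>edges D'. g' e = h (f' e))"
    if g': "involutory_quandle Q'" "coloring Q' D' g'" for Q' :: "(nat \<Rightarrow> int) set magma" and g'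
  proof -
    have corr: "K \<subseteq> edges D \<times> edges D'" "lifts (K\<inverse>) Q' D' D" "determined (Range K) Q' D'"
      using Q'[OF g'(1)] by (simp_all add: color_corr_def)
    have "\<exists>g. coloring Q' D g \<and> (\<forall>e' e. (e', e) \<in> K\<inverse> \<longrightarrow> g' e' = g e)"
      using corr(2)[unfolded lifts_def, rule_format, OF g'(2)] .
    then obtain g where g: "coloring Q' D g" "\<And>e e'. (e, e') \<in> K \<Longrightarrow> g' e' = g e"
      by auto
    obtain h where h: "magma_hom Q Q' h" "\<And>e. e \<in> edges D \<Longrightarrow> g e = h (f e)"
      using f g g' unfolding universal_coloring_def by blast
    have "coloring Q' D' (h \<circ> f')" using h f' by (intro coloring_hom)
    moreover have "\<forall>e\<in>Range K. g' e = (h \<circ> f') e"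
    proof
      fix e' assume "e' \<in> Range K"
      then obtain e where "(e, e') \<in> K" by blast
      moreover from this have "e \<in> edges D" using corr(1) by blast
      ultimately show "g' e' = (h \<circ> f') e'" using f'(2) g(2) h(2) by simp
    qed
    ultimately have "\<forall>e\<in>edges D'. g' e = (h \<circ> f') e"
      using corr(3) g'(2) unfolding determined_def by blast
    then show ?thesis using h by auto
  qed
  then show ?thesis using f' unfolding universal_coloring_def by blast
qed

lemma color_corr_Id_onI:
  assumes "C \<subseteq> edges D" "C \<subseteq> edges D'"
    and "\<And>f. coloring Q D f \<Longrightarrow> \<exists>f'. coloring Q D' f' \<and> (\<forall>e\<in>C. f e = f' e)"
    and "\<And>f. coloring Q D' f \<Longrightarrow> \<exists>f'. coloring Q D f' \<and> (\<forall>e\<in>C. f e = f' e)"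
    and "\<And>f g e. coloring Q D f \<Longrightarrow> coloring Q D g \<Longrightarrow> \<forall>e\<in>C. f e = g e \<Longrightarrow> e \<in> edges D \<Longrightarrow> f e = g e"
    and "\<And>f g e. coloring Q D' f \<Longrightarrow> coloring Q D' g \<Longrightarrow> \<forall>e\<in>C. f e = g e \<Longrightarrow> e \<in> edges D' \<Longrightarrow> f e = g e"
  shows "color_corr (Id_on C) Q D D'"
proof -
  have agree: "(\<forall>e e'. (e, e') \<in> Id_on C \<longrightarrow> f e = f' e') \<longleftrightarrow> (\<forall>e\<in>C. f e = f' e)" for f f' :: "nat \<Rightarrow> 'a"
    by auto
  show ?thesis
    unfolding color_corr_def lifts_def determined_def converse_Id_on Domain_Id_on Range_Id_on agree
    using assms by (intro conjI allI impI ballI) (auto simp: Id_on_def)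
qed

section \<open>Colorings under Reidemeister moves\<close>

definition paired_ends :: "diagram \<Rightarrow> bool" where
  "paired_ends D \<longleftrightarrow> (\<forall>e\<in>edges D. count_list (all_ends D) e = 2)"

lemma paired_endsD: "paired_ends D \<Longrightarrow> count_list (all_ends D) e = 0 \<or> count_list (all_ends D) e = 2"
  using mem_edges_iff unfolding paired_ends_def by blast

lemma paired_ends_mset_cong:
  assumes "mset (all_ends D) = mset (all_ends E)"
  shows "paired_ends D \<longleftrightarrow> paired_ends E"
  unfolding paired_ends_def edges_def
  using assms by (metis count_mset mset_eq_setD)

lemma paired_ends_twiceD:
  assumes "paired_ends D" "mset (all_ends D) = add_mset e (add_mset e (mset xs))"
  shows "e \<notin> set xs"
proof -
  have c: "count_list (all_ends D) e = count_list xs e + 2"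
    using assms(2) by (metis count_add_mset count_mset add_2_eq_Suc')
  then have "count_list xs e = 0" using paired_endsD[OF assms(1), of e] by linarith
  then show ?thesis by (simp add: count_list_0_iff)
qed

lemma color_corr_cong:
  assumes "color_corr K Q D D'" "edges D = edges E" "edges D' = edges E'"
    and "\<And>f. coloring Q D f \<longleftrightarrow> coloring Q E f" "\<And>f. coloring Q D' f \<longleftrightarrow> coloring Q E' f"
  shows "color_corr K Q E E'"
proof -
  have eqs: "coloring Q D = coloring Q E" "coloring Q D' = coloring Q E'"
    by (rule ext, rule assms(4)) (rule ext, rule assms(5))
  show ?thesis
    using assms(1) unfolding color_corr_def lifts_def determined_def assms(2,3) eqs .
qed

lemma color_corr_same:
  assumes "edges D = edges D'" "\<And>f. coloring Q D f \<longleftrightarrow> coloring Q D' f"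
  shows "color_corr (Id_on (edges D)) Q D D'"
  by (rule color_corr_Id_onI) (use assms in auto)

lemma color_corr_permute:
  assumes "mset D = mset D'"
  shows "color_corr (Id_on (edges D)) Q D D'"
proof (rule color_corr_same)
  have s: "set D = set D'" using assms by (rule mset_eq_setD)
  then show e: "edges D = edges D'" by (simp add: edges_def all_ends_def)
  show "coloring Q D f \<longleftrightarrow> coloring Q D' f" for f by (simp add: coloring_def s e)
qed

lemma color_corr_rename:
  assumes "inj_on \<rho> (edges D)"
  shows "color_corr {(e, \<rho> e) | e. e \<in> edges D} Q D (map (relabel \<rho>) D)"
proof -
  let ?K = "{(e, \<rho> e) | e. e \<in> edges D}"
  show ?thesis
    unfolding color_corr_def lifts_def determined_def edges_relabel
  proof (intro conjI allI impI ballI)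
    fix f assume f: "coloring Q D f"
    have "coloring Q (map (relabel \<rho>) D) (f \<circ> inv_into (edges D) \<rho>)"
      unfolding coloring_relabel using f assms by (subst coloring_cong[where g = f]) auto
    then show "\<exists>f'. coloring Q (map (relabel \<rho>) D) f' \<and> (\<forall>e e'. (e, e') \<in> ?K \<longrightarrow> f e = f' e')"
      using assms by (intro exI[of _ "f \<circ> inv_into (edges D) \<rho>"]) auto
  next
    fix f assume "coloring Q (map (relabel \<rho>) D) f"
    then show "\<exists>f'. coloring Q D f' \<and> (\<forall>e e'. (e, e') \<in> ?K\<inverse> \<longrightarrow> f e = f' e')"
      by (intro exI[of _ "f \<circ> \<rho>"]) (auto simp: coloring_relabel)
  qed auto
qed

lemma color_corr_turn_crossing:
  assumes "involutory_quandle Q"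
  shows "color_corr (Id_on (edges (Crossing a b c d # D))) Q (Crossing a b c d # D) (Crossing c d a b # D)"
  by (rule color_corr_same) (use star_invol[OF assms] in \<open>auto simp: coloring_Cons\<close>)

lemma color_corr_turn_joint:
  "color_corr (Id_on (edges (Joint a b # D))) Q (Joint a b # D) (Joint b a # D)"
  by (rule color_corr_same) (auto simp: coloring_Cons)

lemma color_corr_remove_joint:
  assumes "a \<noteq> b" "paired_ends (Joint a b # D)"
  defines "\<rho> \<equiv> id(b := a)"
  shows "color_corr {(e, \<rho> e) | e. e \<in> edges (Joint a b # D)} Q
    (Joint a b # D) (map (relabel \<rho>) D)"
proof -
  have "a \<in> edges D" "b \<in> edges D"
    using assms paired_endsD[OF assms(2), of a] paired_endsD[OF assms(2), of b]
    by (auto simp: all_ends_Cons mem_edges_iff[of _ D])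
  then have e: "edges (map (relabel \<rho>) D) = \<rho> ` edges (Joint a b # D)"
    by (auto simp: edges_relabel \<rho>_def)
  have 1: "coloring Q (map (relabel \<rho>) D) f \<and> (\<forall>e. f (\<rho> e) = f e)" if "coloring Q (Joint a b # D) f" for f
  proof -
    have "f \<circ> \<rho> = f" using that by (auto simp: \<rho>_def coloring_Cons)
    then show ?thesis using that by (auto simp: coloring_relabel coloring_Cons dest: fun_cong)
  qed
  have 2: "coloring Q (Joint a b # D) (f \<circ> \<rho>)" if "coloring Q (map (relabel \<rho>) D) f" for f
  proof -
    have D: "coloring Q D (f \<circ> \<rho>)" using that by (simp add: coloring_relabel)
    then have "(f \<circ> \<rho>) a \<in> elems Q" using \<open>a \<in> edges D\<close> unfolding coloring_def by blast
    then show ?thesis using D \<open>a \<noteq> b\<close> by (simp add: coloring_Cons \<rho>_def)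
  qed
  show ?thesis
    unfolding color_corr_def lifts_def determined_def
  proof (intro conjI allI impI ballI)
    show "{(e, \<rho> e) |e. e \<in> edges (Joint a b # D)} \<subseteq> edges (Joint a b # D) \<times> edges (map (relabel \<rho>) D)"
      using e by auto
  next
    fix f assume "coloring Q (Joint a b # D) f"
    then show "\<exists>f'. coloring Q (map (relabel \<rho>) D) f' \<and>
        (\<forall>e e'. (e, e') \<in> {(e, \<rho> e) |e. e \<in> edges (Joint a b # D)} \<longrightarrow> f e = f' e')"
      using 1[of f] by (intro exI[of _ f]) auto
  next
    fix f assume "coloring Q (map (relabel \<rho>) D) f"
    then show "\<exists>f'. coloring Q (Joint a b # D) f' \<and>
        (\<forall>e e'. (e, e') \<in> {(e, \<rho> e) |e. e \<in> edges (Joint a b # D)}\<inverse> \<longrightarrow> f e = f' e')"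
      using 2[of f] by (intro exI[of _ "f \<circ> \<rho>"]) auto
  qed (use e in auto)
qed

lemma color_corr_R1:
  assumes Q: "involutory_quandle Q" and "paired_ends (Crossing k k a b # D)"
  shows "color_corr (Id_on (edges (Joint a b # D))) Q (Crossing k k a b # D) (Joint a b # D)"
proof -
  have k: "k \<noteq> a" "k \<noteq> b" "k \<notin> edges D"
    using paired_endsD[OF assms(2), of k]
    by (auto simp: all_ends_Cons mem_edges_iff[of _ D] split: if_splits)
  have kink: "f k = f a" if "coloring Q (Crossing k k a b # D) f" for f
    using that star_idem[OF Q, of "f k"] by (simp add: coloring_Cons)
  show ?thesis
  proof (rule color_corr_Id_onI)
    fix f assume "coloring Q (Joint a b # D) f"
    then show "\<exists>f'. coloring Q (Crossing k k a b # D) f' \<and> (\<forall>e\<in>edges (Joint a b # D). f e = f' e)"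
      using k by (intro exI[of _ "f(k := f a)"])
        (auto simp: coloring_Cons coloring_fun_upd star_idem[OF Q])
  next
    fix f assume "coloring Q (Crossing k k a b # D) f"
    then show "\<exists>f'. coloring Q (Joint a b # D) f' \<and> (\<forall>e\<in>edges (Joint a b # D). f e = f' e)"
      by (intro exI[of _ f]) (auto simp: coloring_Cons star_idem[OF Q])
  next
    fix f g e
    assume fg: "coloring Q (Crossing k k a b # D) f" "coloring Q (Crossing k k a b # D) g"
      "\<forall>e\<in>edges (Joint a b # D). f e = g e" "e \<in> edges (Crossing k k a b # D)"
    have "f k = g k" using kink[OF fg(1)] kink[OF fg(2)] fg(3) by simp
    then show "f e = g e" using fg(3,4) by auto
  qed auto
qed

lemma color_corr_R1':
  assumes Q: "involutory_quandle Q" and "paired_ends (Crossing a k k b # D)"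
  shows "color_corr (Id_on (edges (Joint a b # D))) Q (Crossing a k k b # D) (Joint a b # D)"
proof -
  have k: "k \<noteq> a" "k \<noteq> b" "k \<notin> edges D"
    using paired_endsD[OF assms(2), of k]
    by (auto simp: all_ends_Cons mem_edges_iff[of _ D] split: if_splits)
  have eq: "x = y" if "x \<in> elems Q" "y \<in> elems Q" "y = x \<star>\<^bsub>Q\<^esub> y" for x y
    using that star_invol[OF Q, of x y] star_idem[OF Q, of y] by simp
  show ?thesis
  proof (rule color_corr_Id_onI)
    fix f assume "coloring Q (Joint a b # D) f"
    then show "\<exists>f'. coloring Q (Crossing a k k b # D) f' \<and> (\<forall>e\<in>edges (Joint a b # D). f e = f' e)"
      using k by (intro exI[of _ "f(k := f a)"])
        (auto simp: coloring_Cons coloring_fun_upd star_idem[OF Q])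
  next
    fix f assume "coloring Q (Crossing a k k b # D) f"
    then show "\<exists>f'. coloring Q (Joint a b # D) f' \<and> (\<forall>e\<in>edges (Joint a b # D). f e = f' e)"
      using k eq[of "f a" "f k"] by (intro exI[of _ f]) (auto simp: coloring_Cons)
  qed (use k in \<open>auto simp: coloring_Cons\<close>)
qed

lemma color_corr_R2:
  assumes Q: "involutory_quandle Q" and "paired_ends (Crossing s q t p # Crossing t q u r # D)"
  shows "color_corr (Id_on (edges (Joint p r # Joint s u # D))) Q
    (Crossing s q t p # Crossing t q u r # D) (Joint p r # Joint s u # D)"
proof -
  have k: "q \<noteq> t" "q \<noteq> s" "q \<noteq> p" "q \<noteq> u" "q \<noteq> r" "q \<notin> edges D"
    "t \<noteq> s" "t \<noteq> p" "t \<noteq> u" "t \<noteq> r" "t \<notin> edges D"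
    using paired_endsD[OF assms(2), of q] paired_endsD[OF assms(2), of t]
    by (auto simp: all_ends_Cons mem_edges_iff[of _ D] split: if_splits)
  show ?thesis
  proof (rule color_corr_Id_onI)
    fix f assume "coloring Q (Joint p r # Joint s u # D) f"
    then have f: "f p \<in> elems Q" "f s \<in> elems Q" "f r = f p" "f u = f s" "coloring Q D f"
      by (auto simp: coloring_Cons)
    define f' where "f' = f(q := f p, t := f s \<star>\<^bsub>Q\<^esub> f p)"
    have new: "f' q = f p" "f' t = f s \<star>\<^bsub>Q\<^esub> f p" using k by (auto simp: f'_def)
    have old: "f' e = f e" if "e \<noteq> q" "e \<noteq> t" for e using that by (simp add: f'_def)
    have "f' p = f p" "f' s = f s" "f' r = f p" "f' u = f s" using k f old by metis+
    moreover have "coloring Q D f'" using f(5) k by (simp add: f'_def coloring_fun_upd)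
    ultimately have "coloring Q (Crossing s q t p # Crossing t q u r # D) f'"
      using f new by (simp add: coloring_Cons star_invol[OF Q] star_closed[OF Q])
    moreover have "f e = f' e" if "e \<in> edges (Joint p r # Joint s u # D)" for e
      using that k by (intro old[symmetric]) auto
    ultimately show "\<exists>f'. coloring Q (Crossing s q t p # Crossing t q u r # D) f' \<and>
        (\<forall>e\<in>edges (Joint p r # Joint s u # D). f e = f' e)"
      by blast
  next
    fix f assume "coloring Q (Crossing s q t p # Crossing t q u r # D) f"
    then show "\<exists>f'. coloring Q (Joint p r # Joint s u # D) f' \<and>
        (\<forall>e\<in>edges (Joint p r # Joint s u # D). f e = f' e)"
      using k by (intro exI[of _ f]) (auto simp: coloring_Cons star_invol[OF Q])
  next
    let ?D = "Crossing s q t p # Crossing t q u r # D"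
    fix f g e
    assume fg: "coloring Q ?D f" "coloring Q ?D g"
      and C: "\<forall>e\<in>edges (Joint p r # Joint s u # D). f e = g e" and e: "e \<in> edges ?D"
    have eqs: "f q = f p" "f t = f s \<star>\<^bsub>Q\<^esub> f p" if "coloring Q ?D f" for f
      using that by (simp_all add: coloring_Cons)
    then have "f q = g q" "f t = g t" using eqs[OF fg(1)] eqs[OF fg(2)] C by simp_all
    then show "f e = g e" using C e by auto
  qed auto
qed

text \<open>
  The three inner edges keep their labels but change their colors, so they are not identified.
  Self-distributivity is what makes the two colors of the outgoing bottom edge \<open>b3\<close> agree.
\<close>

lemma color_corr_R3:
  assumes Q: "involutory_quandle Q"
    and cl: "paired_ends (Crossing b1 m1 b2 m2 # Crossing b2 t1 b3 t2 # Crossing m2 t2 m3 t3 # D)"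
  shows "color_corr (Id_on ({b1, b3, m1, m3, t1, t3} \<union> edges D)) Q
    (Crossing b1 m1 b2 m2 # Crossing b2 t1 b3 t2 # Crossing m2 t2 m3 t3 # D)
    (Crossing b1 t2 b2 t3 # Crossing m1 t1 m2 t2 # Crossing b2 m2 b3 m3 # D)"
proof -
  have b2: "b2 \<notin> {b1, b3, m1, m2, m3, t1, t2, t3}" "b2 \<notin> edges D"
    using paired_ends_twiceD[OF cl, of b2 "[b1, m1, m2, t1, b3, t2, m2, t2, m3, t3] @ all_ends D"]
    by (auto simp: all_ends_Cons edges_def)
  have m2: "m2 \<notin> {b1, b3, m1, m3, t1, t2, t3}" "m2 \<notin> edges D"
    using paired_ends_twiceD[OF cl, of m2 "[b1, m1, b2, b2, t1, b3, t2, t2, m3, t3] @ all_ends D"]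
    by (auto simp: all_ends_Cons edges_def)
  have t2: "t2 \<notin> {b1, b3, m1, m3, t1, t3}" "t2 \<notin> edges D"
    using paired_ends_twiceD[OF cl, of t2 "[b1, m1, b2, m2, b2, t1, b3, m2, m3, t3] @ all_ends D"]
    by (auto simp: all_ends_Cons edges_def)
  note k = b2 m2 t2
  show ?thesis
  proof (rule color_corr_Id_onI)
    fix f
    assume f: "coloring Q (Crossing b1 m1 b2 m2 # Crossing b2 t1 b3 t2 # Crossing m2 t2 m3 t3 # D) f"
    have fm: "f b1 \<in> elems Q" "f m1 \<in> elems Q" "f t1 \<in> elems Q"
      and eqs: "f m2 = f m1" "f t2 = f t1" "f t3 = f t1" "f b2 = f b1 \<star>\<^bsub>Q\<^esub> f m1"
        "f m3 = f m1 \<star>\<^bsub>Q\<^esub> f t1" "f b3 = (f b1 \<star>\<^bsub>Q\<^esub> f m1) \<star>\<^bsub>Q\<^esub> f t1" "coloring Q D f"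
      using f by (auto simp: coloring_Cons)
    \<comment> \<open>On the new side \<open>b\<close> and \<open>m\<close> pass under \<open>t\<close> first.\<close>
    define f' where "f' = f(t2 := f t1, b2 := f b1 \<star>\<^bsub>Q\<^esub> f t1, m2 := f m1 \<star>\<^bsub>Q\<^esub> f t1)"
    have new: "f' t2 = f t1" "f' b2 = f b1 \<star>\<^bsub>Q\<^esub> f t1" "f' m2 = f m1 \<star>\<^bsub>Q\<^esub> f t1"
      using k by (auto simp: f'_def)
    have old: "f' e = f e" if "e \<in> {b1, b3, m1, m3, t1, t3} \<union> edges D" for e
      using k that unfolding f'_def by (metis UnE fun_upd_other insertCI insertE singletonD)
    have "coloring Q D f'" using eqs(7) coloring_cong[of D f' f] old by auto
    moreover have "f' b1 = f b1" "f' m1 = f m1" "f' t1 = f t1" "f' t3 = f t3" "f' m3 = f m3" "f' b3 = f b3"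
      by (auto intro: old)
    ultimately have "coloring Q (Crossing b1 t2 b2 t3 # Crossing m1 t1 m2 t2 # Crossing b2 m2 b3 m3 # D) f'"
      using new eqs(3,5,6) fm star_distrib[OF Q fm] by (simp add: coloring_Cons star_closed[OF Q])
    then show "\<exists>f'. coloring Q (Crossing b1 t2 b2 t3 # Crossing m1 t1 m2 t2 # Crossing b2 m2 b3 m3 # D) f' \<and>
        (\<forall>e\<in>{b1, b3, m1, m3, t1, t3} \<union> edges D. f e = f' e)"
      using old by (intro exI[of _ f']) auto
  next
    fix f
    assume f: "coloring Q (Crossing b1 t2 b2 t3 # Crossing m1 t1 m2 t2 # Crossing b2 m2 b3 m3 # D) f"
    have fm: "f b1 \<in> elems Q" "f m1 \<in> elems Q" "f t1 \<in> elems Q"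
      and eqs: "f m2 = f m1 \<star>\<^bsub>Q\<^esub> f t1" "f t2 = f t1" "f t3 = f t1" "f b2 = f b1 \<star>\<^bsub>Q\<^esub> f t1"
        "f m3 = f m1 \<star>\<^bsub>Q\<^esub> f t1"
        "f b3 = (f b1 \<star>\<^bsub>Q\<^esub> f t1) \<star>\<^bsub>Q\<^esub> (f m1 \<star>\<^bsub>Q\<^esub> f t1)" "coloring Q D f"
      using f by (auto simp: coloring_Cons)
    \<comment> \<open>On the old side \<open>b\<close> passes under \<open>m\<close> before both pass under \<open>t\<close>.\<close>
    define f' where "f' = f(t2 := f t1, b2 := f b1 \<star>\<^bsub>Q\<^esub> f m1, m2 := f m1)"
    have new: "f' t2 = f t1" "f' b2 = f b1 \<star>\<^bsub>Q\<^esub> f m1" "f' m2 = f m1"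
      using k by (auto simp: f'_def)
    have old: "f' e = f e" if "e \<in> {b1, b3, m1, m3, t1, t3} \<union> edges D" for e
      using k that unfolding f'_def by (metis UnE fun_upd_other insertCI insertE singletonD)
    have "coloring Q D f'" using eqs(7) coloring_cong[of D f' f] old by auto
    moreover have "f' b1 = f b1" "f' m1 = f m1" "f' t1 = f t1" "f' t3 = f t3" "f' m3 = f m3" "f' b3 = f b3"
      by (auto intro: old)
    ultimately have "coloring Q (Crossing b1 m1 b2 m2 # Crossing b2 t1 b3 t2 # Crossing m2 t2 m3 t3 # D) f'"
      using new eqs(3,5,6) fm star_distrib[OF Q fm] by (simp add: coloring_Cons star_closed[OF Q])
    then show "\<exists>f'. coloring Q (Crossing b1 m1 b2 m2 # Crossing b2 t1 b3 t2 # Crossing m2 t2 m3 t3 # D) f' \<and>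
        (\<forall>e\<in>{b1, b3, m1, m3, t1, t3} \<union> edges D. f e = f' e)"
      using old by (intro exI[of _ f']) auto
  next
    let ?D = "Crossing b1 m1 b2 m2 # Crossing b2 t1 b3 t2 # Crossing m2 t2 m3 t3 # D"
    fix f g e
    assume fg: "coloring Q ?D f" "coloring Q ?D g"
      and C: "\<forall>e\<in>{b1, b3, m1, m3, t1, t3} \<union> edges D. f e = g e" and e: "e \<in> edges ?D"
    have eqs: "f t2 = f t1" "f b2 = f b1 \<star>\<^bsub>Q\<^esub> f m1" "f m2 = f m1" if "coloring Q ?D f" for f
      using that by (simp_all add: coloring_Cons)
    then have "f t2 = g t2" "f b2 = g b2" "f m2 = g m2" using eqs[OF fg(1)] eqs[OF fg(2)] C by simp_all
    then show "f e = g e" using C e by auto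
  next
    let ?D = "Crossing b1 t2 b2 t3 # Crossing m1 t1 m2 t2 # Crossing b2 m2 b3 m3 # D"
    fix f g e
    assume fg: "coloring Q ?D f" "coloring Q ?D g"
      and C: "\<forall>e\<in>{b1, b3, m1, m3, t1, t3} \<union> edges D. f e = g e" and e: "e \<in> edges ?D"
    have eqs: "f t2 = f t1" "f b2 = f b1 \<star>\<^bsub>Q\<^esub> f t1" "f m2 = f m1 \<star>\<^bsub>Q\<^esub> f t1" if "coloring Q ?D f" for f
      using that by (simp_all add: coloring_Cons)
    then have "f t2 = g t2" "f b2 = g b2" "f m2 = g m2" using eqs[OF fg(1)] eqs[OF fg(2)] C by simp_all
    then show "f e = g e" using C e by auto
  qed auto
qed

text \<open>
  Exchanging the two over-ends of a crossing does not affect the coloring condition, and turns this move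
  into the other version.
\<close>

lemma color_corr_R3':
  assumes Q: "involutory_quandle Q"
    and cl: "paired_ends (Crossing b1 m2 b2 m1 # Crossing b2 t2 b3 t1 # Crossing m2 t3 m3 t2 # D)"
  shows "color_corr (Id_on ({b1, b3, m1, m3, t1, t3} \<union> edges D)) Q
    (Crossing b1 m2 b2 m1 # Crossing b2 t2 b3 t1 # Crossing m2 t3 m3 t2 # D)
    (Crossing b1 t3 b2 t2 # Crossing m1 t2 m2 t1 # Crossing b2 m3 b3 m2 # D)"
proof (rule color_corr_cong[OF color_corr_R3[OF Q]])
  show "paired_ends (Crossing b1 m1 b2 m2 # Crossing b2 t1 b3 t2 # Crossing m2 t2 m3 t3 # D)"
    using cl by (subst paired_ends_mset_cong) (simp_all add: all_ends_Cons add_mset_commute)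
qed (auto simp: coloring_Cons)

lemma universal_coloring_move:
  assumes Q: "involutory_quandle (Q :: 'q magma)" and "link_diagram D" "link_diagram D'"
    and mv: "move D D' \<or> move D' D"
    and f: "universal_coloring Q D f"
  shows "\<exists>f'. universal_coloring Q D' f'"
proof -
  have "\<exists>K. color_corr K Q D D' \<and>
      (\<forall>Q' :: (nat \<Rightarrow> int) set magma. involutory_quandle Q' \<longrightarrow> color_corr K Q' D D')"
    if "move D D'" "link_diagram D" for D D'
  proof -
    have "paired_ends D" using that(2) by (simp add: link_diagram_def paired_ends_def)
    from that(1) show ?thesis
    proof cases
      case permute
      from \<open>paired_ends D\<close> Q permute show ?thesis
        by - (intro exI conjI allI impI; rule color_corr_permute; assumption)
    next
      case rename
      from \<open>paired_ends D\<close> Q rename(2) show ?thesis unfolding rename(1)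
        by - (intro exI conjI allI impI; rule color_corr_rename; assumption)
    next
      case turn_crossing
      from \<open>paired_ends D\<close> Q  show ?thesis unfolding turn_crossing(1,2)
        by - (intro exI conjI allI impI; rule color_corr_turn_crossing; assumption)
    next
      case turn_joint
      from \<open>paired_ends D\<close> Q  show ?thesis unfolding turn_joint(1,2)
        by - (intro exI conjI allI impI; rule color_corr_turn_joint; assumption)
    next
      case remove_joint
      from \<open>paired_ends D\<close> Q remove_joint(3) show ?thesis unfolding remove_joint(1,2)
        by - (intro exI conjI allI impI; rule color_corr_remove_joint; assumption)
    next
      case R1
      from \<open>paired_ends D\<close> Q  show ?thesis unfolding R1(1,2)
        by - (intro exI conjI allI impI; rule color_corr_R1; assumption)
    next
      case R1'
      from \<open>paired_ends D\<close> Q  show ?thesis unfolding R1'(1,2)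
        by - (intro exI conjI allI impI; rule color_corr_R1'; assumption)
    next
      case R2
      from \<open>paired_ends D\<close> Q  show ?thesis unfolding R2(1,2)
        by - (intro exI conjI allI impI; rule color_corr_R2; assumption)
    next
      case R3
      from \<open>paired_ends D\<close> Q  show ?thesis unfolding R3(1,2)
        by - (intro exI conjI allI impI; rule color_corr_R3; assumption)
    next
      case R3'
      from \<open>paired_ends D\<close> Q  show ?thesis unfolding R3'(1,2)
        by - (intro exI conjI allI impI; rule color_corr_R3'; assumption)
    qed
  qed
  then obtain K where "color_corr K Q D D'"
      "\<And>Q' :: (nat \<Rightarrow> int) set magma. involutory_quandle Q' \<Longrightarrow> color_corr K Q' D D'"
    using mv assms(2,3) color_corr_converse by meson
  then show ?thesis using f by (rule universal_coloring_transfer)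
qed

lemma universal_coloring_link_equiv:
  assumes Q: "involutory_quandle Q" and D: "(D, D') \<in> link_equiv"
    and f: "universal_coloring Q D f"
  shows "\<exists>f'. universal_coloring Q D' f'"
proof -
  define r where "r = {(D, D'). link_diagram D \<and> link_diagram D' \<and> move D D'}"
  have "(D, D') \<in> (r \<union> r\<inverse>)\<^sup>*"
    using D by (simp add: link_equiv_def eq_closure_def r_def)
  then show ?thesis
  proof (induction rule: rtrancl_induct)
    case base
    then show ?case using f by blast
  next
    case (step D1 D2)
    then obtain f1 where "universal_coloring Q D1 f1" by blast
    then show ?case using step(2) universal_coloring_move[OF Q] by (auto simp: r_def)
  qed
qed

section \<open>The involutory quandle carries a universal coloring\<close>

lemma eq_closure_refl [simp]: "(x, x) \<in> eq_closure r"
  by (simp add: eq_closure_def)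

lemma eq_closure_base: "(x, y) \<in> r \<Longrightarrow> (x, y) \<in> eq_closure r"
  by (auto simp: eq_closure_def)

lemma eq_closure_sym: "(x, y) \<in> eq_closure r \<Longrightarrow> (y, x) \<in> eq_closure r"
  unfolding eq_closure_def by (meson sym_Un_converse sym_rtrancl symD)

lemma eq_closure_trans: "(x, y) \<in> eq_closure r \<Longrightarrow> (y, z) \<in> eq_closure r \<Longrightarrow> (x, z) \<in> eq_closure r"
  unfolding eq_closure_def by (rule rtrancl_trans)

lemma eq_closure_map:
  assumes "(x, y) \<in> eq_closure r"
    and "\<And>a b. (a, b) \<in> r \<Longrightarrow> (f a, f b) \<in> eq_closure s"
  shows "(f x, f y) \<in> eq_closure s"
  using assms(1) unfolding eq_closure_def[of r]
proof (induction rule: rtrancl_induct)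
  case (step y z)
  from step.hyps(2) have "(y, z) \<in> r \<or> (z, y) \<in> r" by simp
  then have "(f y, f z) \<in> eq_closure s"
    using assms(2)[of y z] eq_closure_sym[OF assms(2)[of z y]] by auto
  with step.IH show ?case by (rule eq_closure_trans)
qed simp

lemma eq_closure_invariant:
  assumes "(x, y) \<in> eq_closure r" and "\<And>a b. (a, b) \<in> r \<Longrightarrow> f a = f b"
  shows "f x = f y"
  using eq_closure_map[of x y r f "{}"] assms by (auto simp: eq_closure_def)

primrec eval_qterm :: "'q magma \<Rightarrow> ('g \<Rightarrow> 'q) \<Rightarrow> 'g qterm \<Rightarrow> 'q" where
  "eval_qterm Q \<phi> (Gen x) = \<phi> x"
| "eval_qterm Q \<phi> (Op s t) = eval_qterm Q \<phi> s \<star>\<^bsub>Q\<^esub> eval_qterm Q \<phi> t"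

lemma eval_qterm_in_elems:
  assumes "involutory_quandle Q" "\<phi> ` G \<subseteq> elems Q" "t \<in> terms_over G"
  shows "eval_qterm Q \<phi> t \<in> elems Q"
  using assms(3) by (induction t) (use assms(2) star_closed[OF assms(1)] in \<open>auto simp: terms_over_def\<close>)

text \<open>
  Soundness of the derivation system of a presentation.
\<close>

lemma eval_qterm_cong_iq_eq:
  assumes Q: "involutory_quandle Q" and \<phi>: "\<phi> ` G \<subseteq> elems Q"
    and R: "\<And>s t. (s, t) \<in> R \<Longrightarrow> eval_qterm Q \<phi> s = eval_qterm Q \<phi> t"
    and "iq_eq G R s t"
  shows "eval_qterm Q \<phi> s = eval_qterm Q \<phi> t"
  using assms(4)
proof induction
  case (distrib s t u)
  then show ?case using eval_qterm_in_elems[OF Q \<phi>] by (simp add: star_distrib[OF Q])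
qed (use R eval_qterm_in_elems[OF Q \<phi>] in \<open>simp_all add: star_idem[OF Q] star_invol[OF Q]\<close>)

lemma arc_eqI: "(a, b) \<in> arc_rel D \<Longrightarrow> arc D a = arc D b"
  unfolding arc_def arc_rel_def by (auto intro: eq_closure_sym eq_closure_trans)

text \<open>
  The universal property of a quandle given by generators and relations, stated for edges in place of
  arcs: a coloring by a quandle is constant on arcs and satisfies the crossing relations.
\<close>

lemma universal_coloring_IQ: "\<exists>f. universal_coloring (IQ D) D f"
proof -
  define R where "R = {(Gen (arc D c), Op (Gen (arc D a)) (Gen (arc D b))) |
    a b c d. Crossing a b c d \<in> set D}"
  define f where "f e = iq_class (arcs D) R (Gen (arc D e))" for e
  have IQ: "IQ D = presented_iq (arcs D) R" by (simp add: IQ_def R_def)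
  have gen: "Gen (arc D e) \<in> terms_over (arcs D)" if "e \<in> edges D" for e
    using that by (simp add: terms_over_def arcs_def)
  have ends: "e \<in> edges D" if "v \<in> set D" "e \<in> set (ends v)" for v e
    using that by (auto simp: edges_def all_ends_def)
  have el: "elems (IQ D) = iq_class (arcs D) R ` terms_over (arcs D)"
    by (simp add: IQ presented_iq_def)
  have col: "coloring (IQ D) D f"
  proof -
    have "obeys (IQ D) f v" if v: "v \<in> set D" for v
    proof (cases v)
      case (Crossing a b c d)
      have e: "a \<in> edges D" "b \<in> edges D" "c \<in> edges D"
        using ends[OF v] Crossing by auto
      have "arc D b = arc D d"
        by (rule arc_eqI) (use v Crossing in \<open>auto simp: arc_rel_def intro!: eq_closure_base\<close>)
      moreover have "iq_eq (arcs D) R (Gen (arc D c)) (Op (Gen (arc D a)) (Gen (arc D b)))"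
        by (rule iq_eq.rel) (use v Crossing e gen in \<open>auto simp: R_def intro!: Op_terms_over\<close>)
      ultimately show ?thesis
        using gen[OF e(1)] gen[OF e(2)] gen[OF e(3)]
          by (simp add: Crossing f_def IQ star_iq_class iq_class_eq_iff)
    next
      case (Joint a b)
      have "arc D a = arc D b"
        by (rule arc_eqI) (use v Joint in \<open>auto simp: arc_rel_def intro!: eq_closure_base\<close>)
      then show ?thesis by (simp add: Joint f_def)
    qed
    moreover have "f e \<in> elems (IQ D)" if "e \<in> edges D" for e
      using gen[OF that] by (auto simp: el f_def)
    ultimately show ?thesis by (auto simp: coloring_def)
  qed
  have "\<exists>h. magma_hom (IQ D) Q' h \<and> (\<forall>e\<in>edges D. g e = h (f e))"
    if Q': "involutory_quandle Q'" and g: "coloring Q' D g"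
    for Q' :: "(nat \<Rightarrow> int) set magma" and g
  proof -
    define \<phi> where "\<phi> A = g (SOME e. e \<in> A)" for A
    have \<phi>_arc: "\<phi> (arc D e) = g e" for e
    proof -
      have "e \<in> arc D e" by (simp add: arc_def arc_rel_def)
      then have "(SOME e'. e' \<in> arc D e) \<in> arc D e" by (rule someI)
      then have "(e, SOME e'. e' \<in> arc D e) \<in> arc_rel D" by (simp add: arc_def)
      then have "g e = g (SOME e'. e' \<in> arc D e)"
        unfolding arc_rel_def
        by (rule eq_closure_invariant) (use g in \<open>auto simp: coloring_def\<close>)
      then show ?thesis by (simp add: \<phi>_def)
    qed
    have \<phi>: "\<phi> ` arcs D \<subseteq> elems Q'"
      using g by (auto simp: arcs_def \<phi>_arc coloring_def)
    have R: "eval_qterm Q' \<phi> s = eval_qterm Q' \<phi> t" if "(s, t) \<in> R" for s t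
      using that g by (auto simp: R_def \<phi>_arc coloring_def)
    define h where "h X = eval_qterm Q' \<phi> (SOME t. t \<in> X)" for X
    have h: "h (iq_class (arcs D) R s) = eval_qterm Q' \<phi> s" if "s \<in> terms_over (arcs D)" for s
    proof -
      have "s \<in> iq_class (arcs D) R s" using that by (simp add: iq_class_def iq_eq.refl)
      then have "(SOME t. t \<in> iq_class (arcs D) R s) \<in> iq_class (arcs D) R s" by (rule someI)
      then have "iq_eq (arcs D) R s (SOME t. t \<in> iq_class (arcs D) R s)" by (simp add: iq_class_def)
      then show ?thesis unfolding h_def
        using eval_qterm_cong_iq_eq[OF Q' \<phi> R] by metis
    qed
    have "magma_hom (IQ D) Q' h"
      unfolding magma_hom_def el
      using eval_qterm_in_elems[OF Q' \<phi>] by (auto simp: h IQ star_iq_class Op_terms_over)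
    moreover have "g e = h (f e)" if "e \<in> edges D" for e
      using gen[OF that] by (simp add: f_def h \<phi>_arc)
    ultimately show ?thesis by blast
  qed
  then show ?thesis using col unfolding universal_coloring_def by blast
qed

section \<open>Darts, faces and planarity\<close>

lemma mem_darts: "(i, s) \<in> darts D \<longleftrightarrow> i < length D \<and> s < length (ends (D ! i))"
  by (simp add: darts_def)

lemma finite_darts: "finite (darts D)"
proof -
  have "darts D = (SIGMA i:{..<length D}. {..<length (ends (D ! i))})"
    by (auto simp: darts_def)
  then show ?thesis by simp
qed

lemma ends_nonempty: "0 < length (ends v)"
  by (cases v) auto

lemma rotate_dart_in_darts: "d \<in> darts D \<Longrightarrow> rotate_dart D d \<in> darts D"
  by (cases d) (auto simp: mem_darts rotate_dart_def intro!: mod_less_divisor ends_nonempty)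

lemma darts_Cons:
  "darts (v # D) = Pair 0 ` {..<length (ends v)} \<union> (\<lambda>(i, s). (Suc i, s)) ` darts D"
proof (rule set_eqI)
  fix d :: "nat \<times> nat"
  obtain i s where "d = (i, s)" by fastforce
  then show "d \<in> darts (v # D) \<longleftrightarrow>
      d \<in> Pair 0 ` {..<length (ends v)} \<union> (\<lambda>(i, s). (Suc i, s)) ` darts D"
    by (cases i) (auto simp: mem_darts image_iff Bex_def)
qed

text \<open>
  Links counting of edge labels in the planar diagram code with counting of darts, so that the partner of
  a dart exists and is unique.
\<close>

lemma count_list_all_ends: "count_list (all_ends D) e = card {d \<in> darts D. label D d = e}"
proof (induction D)
  case Nil
  then show ?case by (simp add: all_ends_def darts_def)
next
  case (Cons v D)
  let ?A = "{s. s < length (ends v) \<and> ends v ! s = e}" and ?B = "{d \<in> darts D. label D d = e}"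
  let ?U = "Pair 0 ` ?A \<union> (\<lambda>(i, s). (Suc i, s)) ` ?B"
  have U: "{d \<in> darts (v # D). label (v # D) d = e} = ?U"
    by (auto simp: darts_Cons label_def image_iff Bex_def)
  have "card ?U = card (Pair (0::nat) ` ?A) + card ((\<lambda>(i, s). (Suc i, s)) ` ?B)"
    by (rule card_Un_disjoint) (auto simp: finite_darts)
  also have "card (Pair (0::nat) ` ?A) = card ?A"
    by (rule card_image) (simp add: inj_on_def)
  also have "card ?A = count_list (ends v) e"
    unfolding count_list_eq_length_filter length_filter_conv_card
    by (rule arg_cong[of _ _ card]) auto
  also have "card ((\<lambda>(i, s). (Suc i, s)) ` ?B) = card ?B"
    by (rule card_image) (auto simp: inj_on_def)
  finally show ?case unfolding U using Cons by (simp add: all_ends_Cons)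
qed

lemma label_in_edges:
  assumes "d \<in> darts D"
  shows "label D d \<in> edges D"
proof -
  have "d \<in> {x \<in> darts D. label D x = label D d}" "finite {x \<in> darts D. label D x = label D d}"
    using assms finite_darts by simp_all
  then show ?thesis
    unfolding mem_edges_iff count_list_all_ends by (metis card_0_eq empty_iff)
qed

lemma paired_ends_unique_other_dart:
  assumes "paired_ends D" "d \<in> darts D"
  shows "\<exists>d'. {x \<in> darts D. label D x = label D d} = {d, d'} \<and> d' \<noteq> d"
proof -
  have "card {x \<in> darts D. label D x = label D d} = 2"
    using assms label_in_edges by (auto simp: paired_ends_def count_list_all_ends)
  then obtain x y where xy: "{x \<in> darts D. label D x = label D d} = {x, y}" "x \<noteq> y"
    by (auto simp: card_2_iff)
  moreover have "d \<in> {x, y}" using assms unfolding xy(1)[symmetric] by simp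
  ultimately show ?thesis by (metis (no_types, lifting) insertE insert_commute singletonD)
qed

lemma opposite_eqI:
  assumes "paired_ends D" "d \<in> darts D" "d' \<in> darts D" "d' \<noteq> d" "label D d' = label D d"
  shows "opposite D d = d'"
proof -
  obtain x where x: "{x \<in> darts D. label D x = label D d} = {d, x}"
    using paired_ends_unique_other_dart[OF assms(1,2)] by blast
  have "y = x" if "y \<in> darts D" "y \<noteq> d" "label D y = label D d" for y using x that by blast
  then show ?thesis unfolding opposite_def using assms(3-5) by (intro the_equality) metis+
qed

lemma opposite:
  assumes "paired_ends D" "d \<in> darts D"
  shows "opposite D d \<in> darts D" "opposite D d \<noteq> d" "label D (opposite D d) = label D d"
proof -
  obtain x where "{x \<in> darts D. label D x = label D d} = {d, x}" "x \<noteq> d"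
    using paired_ends_unique_other_dart[OF assms] by blast
  then have x: "x \<in> darts D" "x \<noteq> d" "label D x = label D d" by blast+
  then have "opposite D d = x" using assms by (intro opposite_eqI)
  then show "opposite D d \<in> darts D" "opposite D d \<noteq> d" "label D (opposite D d) = label D d"
    using x by simp_all
qed

lemma opposite_opposite:
  assumes "paired_ends D" "d \<in> darts D"
  shows "opposite D (opposite D d) = d"
  using opposite[OF assms] assms by (intro opposite_eqI) auto

lemma card_quotient_le:
  assumes "finite X'" "f ` X \<subseteq> X'"
    and refl: "\<And>x y. x \<in> X \<Longrightarrow> y \<in> X \<Longrightarrow> (f x, f y) \<in> eq_closure r' \<Longrightarrow> (x, y) \<in> eq_closure r"
  shows "card (X // eq_closure r) \<le> card (X' // eq_closure r')"
proof (rule surj_card_le)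
  show "finite (X' // eq_closure r')" using assms(1) by (simp add: quotient_def)
  show "X // eq_closure r \<subseteq>
      (\<lambda>c. eq_closure r `` {SOME y. y \<in> X \<and> f y \<in> c}) ` (X' // eq_closure r')"
  proof
    fix c assume "c \<in> X // eq_closure r"
    then obtain x where x: "x \<in> X" "c = eq_closure r `` {x}" by (auto simp: quotient_def)
    define y where "y = (SOME y. y \<in> X \<and> f y \<in> eq_closure r' `` {f x})"
    have "y \<in> X \<and> f y \<in> eq_closure r' `` {f x}"
      unfolding y_def by (rule someI[of _ x]) (simp add: x)
    then have "(x, y) \<in> eq_closure r" using refl x by simp
    then have "c = eq_closure r `` {y}"
      unfolding x(2) by (auto intro: eq_closure_sym eq_closure_trans)
    moreover have "eq_closure r' `` {f x} \<in> X' // eq_closure r'"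
      using x assms(2) by (auto simp: quotient_def)
    ultimately show "c \<in> (\<lambda>c. eq_closure r `` {SOME y. y \<in> X \<and> f y \<in> c}) ` (X' // eq_closure r')"
      unfolding y_def by blast
  qed
qed

text \<open>
  The tool for counting faces and components: two maps that respect the generating relations and are
  inverse to each other up to equivalence induce a bijection of classes.
\<close>

lemma card_quotient_eq:
  assumes "finite X" "finite X'" "f ` X \<subseteq> X'" "g ` X' \<subseteq> X"
    and f: "\<And>x y. (x, y) \<in> r \<Longrightarrow> (f x, f y) \<in> eq_closure r'"
    and g: "\<And>x y. (x, y) \<in> r' \<Longrightarrow> (g x, g y) \<in> eq_closure r"
    and gf: "\<And>x. x \<in> X \<Longrightarrow> (g (f x), x) \<in> eq_closure r"
    and fg: "\<And>x. x \<in> X' \<Longrightarrow> (f (g x), x) \<in> eq_closure r'"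
  shows "card (X // eq_closure r) = card (X' // eq_closure r')"
proof (rule antisym)
  show "card (X // eq_closure r) \<le> card (X' // eq_closure r')"
  proof (rule card_quotient_le[OF assms(2,3)])
    fix x y assume xy: "x \<in> X" "y \<in> X" "(f x, f y) \<in> eq_closure r'"
    have "(g (f x), g (f y)) \<in> eq_closure r" using xy(3) g by (rule eq_closure_map)
    then show "(x, y) \<in> eq_closure r"
      using gf[OF xy(1)] gf[OF xy(2)] by (meson eq_closure_sym eq_closure_trans)
  qed
  show "card (X' // eq_closure r') \<le> card (X // eq_closure r)"
  proof (rule card_quotient_le[OF assms(1,4)])
    fix x y assume xy: "x \<in> X'" "y \<in> X'" "(g x, g y) \<in> eq_closure r"
    have "(f (g x), f (g y)) \<in> eq_closure r'" using xy(3) f by (rule eq_closure_map)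
    then show "(x, y) \<in> eq_closure r'"
      using fg[OF xy(1)] fg[OF xy(2)] by (meson eq_closure_sym eq_closure_trans)
  qed
qed

text \<open>
  Accounts for the face inside a kink, which disappears with the kink.
\<close>

lemma card_quotient_insert_singleton_class:
  assumes "finite X" "m \<notin> X" and m: "\<And>x. (m, x) \<in> eq_closure r \<Longrightarrow> x = m"
  shows "card (insert m X // eq_closure r) = Suc (card (X // eq_closure r))"
proof -
  have "eq_closure r `` {m} = {m}" using m by auto
  then have "insert m X // eq_closure r = insert {m} (X // eq_closure r)"
    by (auto simp: quotient_def)
  moreover have "{m} \<notin> X // eq_closure r"
  proof
    assume "{m} \<in> X // eq_closure r"
    then obtain x where "x \<in> X" "{m} = eq_closure r `` {x}" by (auto simp: quotient_def)
    moreover have "x \<in> eq_closure r `` {x}" by simp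
    ultimately have "x \<in> X" "x \<in> {m}" by blast+
    then show False using assms(2) by simp
  qed
  moreover have "finite (X // eq_closure r)" using assms(1) by (simp add: quotient_def)
  ultimately show ?thesis by simp
qed

definition face_step :: "diagram \<Rightarrow> nat \<times> nat \<Rightarrow> nat \<times> nat" where
  "face_step D d = rotate_dart D (opposite D d)"

definition face_rel :: "diagram \<Rightarrow> ((nat \<times> nat) \<times> (nat \<times> nat)) set" where
  "face_rel D = {(d, face_step D d) | d. d \<in> darts D}"

definition component_rel :: "diagram \<Rightarrow> ((nat \<times> nat) \<times> (nat \<times> nat)) set" where
  "component_rel D =
     {(d, opposite D d) | d. d \<in> darts D} \<union> {(d, rotate_dart D d) | d. d \<in> darts D}"

lemma faces_eq: "faces D = darts D // eq_closure (face_rel D)"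
  by (simp add: faces_def face_rel_def face_step_def)

lemma components_eq: "components D = darts D // eq_closure (component_rel D)"
  by (simp add: components_def component_rel_def)

text \<open>
  An isomorphism of rotation systems that also preserves labels.  It may exchange over- and
  under-passages: planarity does not see them.
\<close>

definition dart_iso :: "(nat \<times> nat \<Rightarrow> nat \<times> nat) \<Rightarrow> diagram \<Rightarrow> diagram \<Rightarrow> bool" where
  "dart_iso \<gamma> E D \<longleftrightarrow> bij_betw \<gamma> (darts E) (darts D) \<and>
     (\<forall>d\<in>darts E. label D (\<gamma> d) = label E d \<and> \<gamma> (rotate_dart E d) = rotate_dart D (\<gamma> d))"

lemma dart_iso_opposite:
  assumes "dart_iso \<gamma> E D" "paired_ends E" "paired_ends D" "d \<in> darts E"
  shows "\<gamma> (opposite E d) = opposite D (\<gamma> d)"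
proof (rule opposite_eqI[symmetric])
  note o = opposite[OF assms(2,4)]
  have \<gamma>: "inj_on \<gamma> (darts E)" "\<gamma> ` darts E = darts D"
    using assms(1) by (auto simp: dart_iso_def bij_betw_def)
  show "\<gamma> (opposite E d) \<noteq> \<gamma> d" using \<gamma>(1) o assms(4) by (auto dest: inj_onD)
  show "\<gamma> d \<in> darts D" "\<gamma> (opposite E d) \<in> darts D" using \<gamma>(2) o assms(4) by blast+
  show "label D (\<gamma> (opposite E d)) = label D (\<gamma> d)"
    using assms(1,4) o by (simp add: dart_iso_def)
qed (rule assms)

lemma card_quotient_bij:
  assumes "finite X" "bij_betw \<gamma> X X'" "r \<subseteq> X \<times> X" "r' = (\<lambda>(x, y). (\<gamma> x, \<gamma> y)) ` r"
  shows "card (X // eq_closure r) = card (X' // eq_closure r')"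
proof (rule card_quotient_eq[where f = \<gamma> and g = "inv_into X \<gamma>"])
  have inj: "inj_on \<gamma> X" and im: "\<gamma> ` X = X'" using assms(2) by (auto simp: bij_betw_def)
  show "finite X" "finite X'" "\<gamma> ` X \<subseteq> X'" "inv_into X \<gamma> ` X' \<subseteq> X"
    using assms(1) im by (auto intro: inv_into_into)
  show "(\<gamma> x, \<gamma> y) \<in> eq_closure r'" if "(x, y) \<in> r" for x y
    using that assms(4) by (force intro: eq_closure_base)
  show "(inv_into X \<gamma> x, inv_into X \<gamma> y) \<in> eq_closure r" if xy: "(x, y) \<in> r'" for x y
  proof -
    obtain a b where "(a, b) \<in> r" "x = \<gamma> a" "y = \<gamma> b" using xy assms(4) by auto
    then show ?thesis using assms(3) inj by (auto intro!: eq_closure_base)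
  qed
  show "(inv_into X \<gamma> (\<gamma> x), x) \<in> eq_closure r" if "x \<in> X" for x using that inj by simp
  show "(\<gamma> (inv_into X \<gamma> x), x) \<in> eq_closure r'" if "x \<in> X'" for x
    using that im by (simp add: f_inv_into_f)
qed

lemma face_step_in_darts: "paired_ends D \<Longrightarrow> d \<in> darts D \<Longrightarrow> face_step D d \<in> darts D"
  unfolding face_step_def by (intro rotate_dart_in_darts opposite)

lemma planar_dart_iso:
  assumes \<gamma>: "dart_iso \<gamma> E D" and cl: "paired_ends E" "paired_ends D"
    and "length E = length D" "edges E = edges D"
  shows "planar E \<longleftrightarrow> planar D"
proof -
  have bij: "bij_betw \<gamma> (darts E) (darts D)" using \<gamma> by (simp add: dart_iso_def)
  then have im: "darts D = \<gamma> ` darts E" by (simp add: bij_betw_def)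
  have rot: "\<gamma> (rotate_dart E d) = rotate_dart D (\<gamma> d)" if "d \<in> darts E" for d
    using that \<gamma> by (simp add: dart_iso_def)
  have opp: "\<gamma> (opposite E d) = opposite D (\<gamma> d)" if "d \<in> darts E" for d
    using dart_iso_opposite[OF \<gamma> cl that] .
  have step: "\<gamma> (face_step E d) = face_step D (\<gamma> d)" if "d \<in> darts E" for d
    using that opposite[OF cl(1) that] rot opp by (simp add: face_step_def)
  have "card (faces E) = card (faces D)"
    unfolding faces_eq
  proof (rule card_quotient_bij[OF finite_darts bij])
    show "face_rel E \<subseteq> darts E \<times> darts E"
      using face_step_in_darts[OF cl(1)] by (auto simp: face_rel_def)
    show "face_rel D = (\<lambda>(x, y). (\<gamma> x, \<gamma> y)) ` face_rel E"
      using step by (force simp: face_rel_def im image_iff)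
  qed
  moreover have "card (components E) = card (components D)"
    unfolding components_eq
  proof (rule card_quotient_bij[OF finite_darts bij])
    show "component_rel E \<subseteq> darts E \<times> darts E"
      using opposite[OF cl(1)] rotate_dart_in_darts by (auto simp: component_rel_def)
    have "component_rel D = (\<lambda>d. (\<gamma> d, opposite D (\<gamma> d))) ` darts E \<union>
        (\<lambda>d. (\<gamma> d, rotate_dart D (\<gamma> d))) ` darts E"
      unfolding component_rel_def im by blast
    also have "\<dots> = (\<lambda>d. (\<gamma> d, \<gamma> (opposite E d))) ` darts E \<union>
        (\<lambda>d. (\<gamma> d, \<gamma> (rotate_dart E d))) ` darts E"
      using opp rot by (intro arg_cong2[where f = "(\<union>)"] image_cong) auto
    also have "\<dots> = (\<lambda>(x, y). (\<gamma> x, \<gamma> y)) ` component_rel E"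
      unfolding component_rel_def by force
    finally show "component_rel D = (\<lambda>(x, y). (\<gamma> x, \<gamma> y)) ` component_rel E" .
  qed
  ultimately show ?thesis using assms(4,5) by (simp add: planar_def)
qed

lemma alternating_dart_iso:
  assumes \<gamma>: "dart_iso \<gamma> E D"
    and par: "\<And>d. d \<in> darts E \<Longrightarrow> is_crossing (E ! fst d) \<Longrightarrow>
      is_crossing (D ! fst (\<gamma> d)) \<and> (odd (snd (\<gamma> d)) \<longleftrightarrow> odd (snd d))"
    and seg: "segment_rel E = segment_rel D"
    and alt: "alternating_diagram D"
  shows "alternating_diagram E"
  unfolding alternating_diagram_def
proof (intro ballI impI)
  fix d d'
  assume d: "d \<in> crossing_darts E" "d' \<in> crossing_darts E"
    and dd: "d \<noteq> d' \<and> (label E d, label E d') \<in> segment_rel E"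
  have in_E: "d \<in> darts E" "d' \<in> darts E" using d by (auto simp: crossing_darts_def)
  have "inj_on \<gamma> (darts E)" "\<gamma> ` darts E = darts D" using \<gamma> by (auto simp: dart_iso_def bij_betw_def)
  then have "\<gamma> d \<noteq> \<gamma> d'" "\<gamma> d \<in> crossing_darts D" "\<gamma> d' \<in> crossing_darts D"
    using d dd par in_E by (auto simp: crossing_darts_def dest: inj_onD)
  moreover have "(label D (\<gamma> d), label D (\<gamma> d')) \<in> segment_rel D"
    using dd \<gamma> in_E seg by (simp add: dart_iso_def)
  ultimately have "odd (snd (\<gamma> d)) \<noteq> odd (snd (\<gamma> d'))"
    using alt unfolding alternating_diagram_def by blast
  moreover have "is_crossing (E ! fst d)" "is_crossing (E ! fst d')" using d by (auto simp: crossing_darts_def)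
  ultimately show "odd (snd d) \<noteq> odd (snd d')" using par in_E by blast
qed

lemma dart_iso_permute:
  assumes "bij_betw p {..<length E} {..<length D}" "\<And>i. i < length E \<Longrightarrow> E ! i = D ! p i"
  shows "dart_iso (map_prod p id) E D"
proof -
  have inj: "inj_on p {..<length E}" and im: "p ` {..<length E} = {..<length D}"
    using assms(1) by (auto simp: bij_betw_def)
  have pl: "p i < length D" if "i < length E" for i using im that by blast
  have "inj_on (map_prod p id) (darts E)"
    using inj by (auto simp: inj_on_def mem_darts)
  moreover have "map_prod p id ` darts E = darts D"
  proof
    show "map_prod p id ` darts E \<subseteq> darts D" using assms(2) pl by (auto simp: mem_darts)
    show "darts D \<subseteq> map_prod p id ` darts E"
    proof
      fix d assume d: "d \<in> darts D"
      then have "fst d \<in> p ` {..<length E}" unfolding im by (auto simp: darts_def)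
      then obtain i where "i < length E" "fst d = p i" by auto
      then show "d \<in> map_prod p id ` darts E"
        using d assms(2) by (intro image_eqI[of _ _ "(i, snd d)"]) (auto simp: darts_def)
    qed
  qed
  ultimately show ?thesis
    using assms(2) by (auto simp: dart_iso_def bij_betw_def mem_darts label_def rotate_dart_def)
qed

lemma mod_Suc_eq_cases: "s < n \<Longrightarrow> Suc s mod n = (if Suc s = n then 0 else Suc s)"
  by (auto simp: Suc_lessI)

text \<open>
  Renumbering the ends of the first vertex cyclically.  Applied to crossings and to joints, it reduces both
  chiralities of a kink to one.
\<close>

lemma dart_iso_rotate_head:
  assumes "ends w = rotate1 (ends v)"
  shows "dart_iso (\<lambda>d. if fst d = 0 then rotate_dart (v # D) d else d) (w # D) (v # D)"
    (is "dart_iso ?\<gamma> _ _")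
proof -
  let ?n = "length (ends v)"
  have len: "length (ends w) = ?n" using assms by simp
  have darts: "darts (w # D) = darts (v # D)" by (simp add: darts_Cons len)
  have "inj_on ?\<gamma> (darts (v # D))"
    by (auto simp: inj_on_def mem_darts rotate_dart_def mod_Suc_eq_cases split: if_splits)
  moreover have "?\<gamma> ` darts (v # D) \<subseteq> darts (v # D)"
    using rotate_dart_in_darts by auto
  ultimately have "bij_betw ?\<gamma> (darts (w # D)) (darts (v # D))"
    unfolding darts bij_betw_def using endo_inj_surj[OF finite_darts] by blast
  moreover have "label (v # D) (?\<gamma> d) = label (w # D) d \<and>
      ?\<gamma> (rotate_dart (w # D) d) = rotate_dart (v # D) (?\<gamma> d)" if "d \<in> darts (w # D)" for d
    using that
    by (cases d; cases "fst d")
      (auto simp: mem_darts label_def rotate_dart_def len assms nth_rotate1 ends_nonempty)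
  ultimately show ?thesis by (simp add: dart_iso_def)
qed

lemma edges_mset_cong: "mset (all_ends D) = mset (all_ends E) \<Longrightarrow> edges D = edges E"
  unfolding edges_def by (rule mset_eq_setD)

lemma rotate_head:
  assumes "ends w = rotate1 (ends v)"
  shows "paired_ends (w # D) \<longleftrightarrow> paired_ends (v # D)"
    and "paired_ends (v # D) \<Longrightarrow> planar (w # D) \<longleftrightarrow> planar (v # D)"
proof -
  have ms: "mset (all_ends (w # D)) = mset (all_ends (v # D))"
    by (cases "ends v") (simp_all add: all_ends_Cons assms)
  show cl: "paired_ends (w # D) \<longleftrightarrow> paired_ends (v # D)" using ms by (rule paired_ends_mset_cong)
  show "planar (w # D) \<longleftrightarrow> planar (v # D)" if "paired_ends (v # D)"
    using that cl edges_mset_cong[OF ms]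
    by (intro planar_dart_iso[OF dart_iso_rotate_head[OF assms]]) simp_all
qed

lemma mset_all_ends: "mset (all_ends D) = (\<Sum>v\<in>#mset D. mset (ends v))"
  by (induction D) (simp_all add: all_ends_Cons, simp add: all_ends_def)

lemma paired_ends_permute:
  assumes "mset D = mset E"
  shows "paired_ends D \<longleftrightarrow> paired_ends E" "edges D = edges E"
proof -
  have ms: "mset (all_ends D) = mset (all_ends E)"
    unfolding mset_all_ends assms ..
  show "paired_ends D \<longleftrightarrow> paired_ends E" using ms by (rule paired_ends_mset_cong)
  show "edges D = edges E" using ms by (rule edges_mset_cong)
qed

lemma link_diagram_iff: "link_diagram D \<longleftrightarrow> D \<noteq> [] \<and> paired_ends D \<and> planar D"
  by (simp add: link_diagram_def paired_ends_def)

lemma permute_link_diagram: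
  assumes "mset E = mset D" "link_diagram D"
  shows "link_diagram E" "alternating_diagram D \<Longrightarrow> alternating_diagram E"
proof -
  obtain p where p: "bij_betw p {..<length E} {..<length D}" "\<And>i. i < length E \<Longrightarrow> E ! i = D ! p i"
    using permutation_Ex_bij[OF assms(1)] by blast
  note iso = dart_iso_permute[OF p]
  show "link_diagram E"
    using assms paired_ends_permute[OF assms(1)] planar_dart_iso[OF iso] mset_eq_length[OF assms(1)]
    by (auto simp: link_diagram_iff)
  have "segment_rel E = segment_rel D"
    unfolding segment_rel_def using mset_eq_setD[OF assms(1)] by simp
  then show "alternating_diagram E" if "alternating_diagram D"
    using that p(2) by (intro alternating_dart_iso[OF iso]) (auto simp: darts_def)
qed

lemma turn_crossing_link_diagram:
  assumes "link_diagram (Crossing a b c d # D)"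
  shows "link_diagram (Crossing c d a b # D)"
proof -
  have "link_diagram (Crossing b c d a # D)"
    using assms rotate_head[of "Crossing b c d a" "Crossing a b c d" D] by (simp add: link_diagram_iff)
  then show ?thesis
    using rotate_head[of "Crossing c d a b" "Crossing b c d a" D] by (simp add: link_diagram_iff)
qed

text \<open>
  Half a turn shifts the position at the crossing by two, which keeps its parity.
\<close>

lemma turn_crossing_alternating:
  assumes "alternating_diagram (Crossing a b c d # D)"
  shows "alternating_diagram (Crossing c d a b # D)"
proof (rule alternating_dart_iso[OF _ _ _ assms])
  let ?D = "Crossing a b c d # D" and ?E = "Crossing c d a b # D"
  let ?\<gamma> = "\<lambda>x. if fst x = 0 then rotate_dart ?D (rotate_dart ?D x) else x"
  have darts: "darts ?E = darts ?D" by (simp add: darts_Cons)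
  have head: "s = 0 \<or> s = 1 \<or> s = 2 \<or> s = 3" if "(0, s) \<in> darts ?D" for s
    using that by (auto simp: mem_darts)
  have "inj_on ?\<gamma> (darts ?D)"
  proof (rule inj_onI)
    fix x y assume xy: "x \<in> darts ?D" "y \<in> darts ?D" "?\<gamma> x = ?\<gamma> y"
    obtain i s j t where [simp]: "x = (i, s)" "y = (j, t)" by fastforce
    show "x = y" using xy head[of s] head[of t]
      by (auto simp: rotate_dart_def split: if_splits)
  qed
  moreover have "?\<gamma> ` darts ?D \<subseteq> darts ?D"
    by (intro image_subsetI) (simp add: rotate_dart_in_darts)
  ultimately have "bij_betw ?\<gamma> (darts ?E) (darts ?D)"
    unfolding darts bij_betw_def using endo_inj_surj[OF finite_darts] by blast
  moreover have "label ?D (?\<gamma> x) = label ?E x \<and>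
      ?\<gamma> (rotate_dart ?E x) = rotate_dart ?D (?\<gamma> x)" if x: "x \<in> darts ?E" for x
  proof (cases "fst x")
    case 0
    then obtain s where [simp]: "x = (0, s)" by (cases x) auto
    have "s = 0 \<or> s = 1 \<or> s = 2 \<or> s = 3" using head[of s] x unfolding darts by simp
    then show ?thesis by (elim disjE) (simp_all add: label_def rotate_dart_def)
  next
    case (Suc i)
    then show ?thesis by (simp add: label_def rotate_dart_def)
  qed
  ultimately show "dart_iso ?\<gamma> ?E ?D" by (simp add: dart_iso_def)
  show "is_crossing (?D ! fst (?\<gamma> x)) \<and> (odd (snd (?\<gamma> x)) \<longleftrightarrow> odd (snd x))"
    if x: "x \<in> darts ?E" "is_crossing (?E ! fst x)" for x
  proof (cases "fst x")
    case 0
    then obtain s where [simp]: "x = (0, s)" by (cases x) auto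
    have "s = 0 \<or> s = 1 \<or> s = 2 \<or> s = 3" using head[of s] x unfolding darts by simp
    then show ?thesis by (elim disjE) (simp_all add: rotate_dart_def)
  next
    case (Suc i)
    then show ?thesis using x by simp
  qed
  show "segment_rel ?E = segment_rel ?D" by (simp add: segment_rel_def)
qed

section \<open>Removing joints\<close>

lemma face_stepI: "d \<in> darts D \<Longrightarrow> (d, face_step D d) \<in> eq_closure (face_rel D)"
  by (rule eq_closure_base) (unfold face_rel_def, blast)

lemma component_oppositeI: "d \<in> darts D \<Longrightarrow> (d, opposite D d) \<in> eq_closure (component_rel D)"
  by (rule eq_closure_base) (unfold component_rel_def, blast)

lemma component_rotateI: "d \<in> darts D \<Longrightarrow> (d, rotate_dart D d) \<in> eq_closure (component_rel D)"
  by (rule eq_closure_base) (unfold component_rel_def, blast)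

text \<open>
  Position of a dart after a vertex has been put in front of the diagram.
\<close>

definition shift :: "nat \<times> nat \<Rightarrow> nat \<times> nat" where
  "shift d = (Suc (fst d), snd d)"

definition unshift :: "nat \<times> nat \<Rightarrow> nat \<times> nat" where
  "unshift d = (fst d - 1, snd d)"

lemma unshift_shift [simp]: "unshift (shift d) = d"
  by (simp add: shift_def unshift_def)

lemma shift_eq_iff [simp]: "shift d = shift d' \<longleftrightarrow> d = d'"
  by (cases d; cases d') (simp add: shift_def)

lemma shift_in_darts [simp]: "shift d \<in> darts (v # D) \<longleftrightarrow> d \<in> darts D"
  by (cases d) (simp add: shift_def mem_darts)

lemma label_shift [simp]: "label (v # D) (shift d) = label D d"
  by (simp add: label_def shift_def)

lemma rotate_dart_shift [simp]: "rotate_dart (v # D) (shift d) = shift (rotate_dart D d)"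
  by (simp add: rotate_dart_def shift_def)

lemma dart_Cons_cases:
  assumes "d \<in> darts (v # D)"
  obtains s where "d = (0, s)" "s < length (ends v)" | d' where "d = shift d'" "d' \<in> darts D"
proof (cases d)
  case (Pair i s)
  then show thesis
  proof (cases i)
    case 0
    then show thesis using that(1) assms Pair by (auto simp: mem_darts)
  next
    case (Suc j)
    then have "d = shift (j, s)" using Pair by (simp add: shift_def)
    then show thesis using that(2) assms by simp
  qed
qed

lemma count_list_relabel:
  assumes "a \<noteq> b"
  shows "count_list (map (id(b := a)) xs) e =
    (if e = a then count_list xs a + count_list xs b else if e = b then 0 else count_list xs e)"
  by (induction xs) (use assms in auto)

lemma all_ends_relabel: "all_ends (map (relabel \<rho>) D) = map \<rho> (all_ends D)"
  by (induction D) (auto simp: all_ends_def ends_relabel)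

lemma darts_relabel: "darts (map (relabel \<rho>) D) = darts D"
  by (auto simp: darts_def ends_relabel)

lemma label_relabel: "d \<in> darts D \<Longrightarrow> label (map (relabel \<rho>) D) d = \<rho> (label D d)"
  by (auto simp: darts_def label_def ends_relabel)

lemma rotate_dart_relabel: "d \<in> darts D \<Longrightarrow> rotate_dart (map (relabel \<rho>) D) d = rotate_dart D d"
  by (auto simp: darts_def rotate_dart_def ends_relabel)

lemma paired_ends_remove_joint:
  assumes "a \<noteq> b" "paired_ends (Joint a b # D)"
  shows "paired_ends (map (relabel (id(b := a))) D)"
    and "edges (Joint a b # D) = insert b (edges (map (relabel (id(b := a))) D))"
    and "b \<notin> edges (map (relabel (id(b := a))) D)"
    and "a \<in> edges D"
proof -
  have c: "count_list (all_ends D) a = 1" "count_list (all_ends D) b = 1"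
    using assms(1) paired_endsD[OF assms(2), of a] paired_endsD[OF assms(2), of b]
    by (auto simp: all_ends_Cons)
  then show a: "a \<in> edges D" by (simp add: mem_edges_iff)
  have b: "b \<in> edges D" using c by (simp add: mem_edges_iff)
  have "count_list (map (id(b := a)) (all_ends D)) e = 2"
    if "count_list (map (id(b := a)) (all_ends D)) e \<noteq> 0" for e
    using that c paired_endsD[OF assms(2), of e] unfolding count_list_relabel[OF assms(1)]
    by (auto simp: all_ends_Cons split: if_splits)
  then show "paired_ends (map (relabel (id(b := a))) D)"
    by (simp add: paired_ends_def mem_edges_iff all_ends_relabel)
  show "edges (Joint a b # D) = insert b (edges (map (relabel (id(b := a))) D))"
    using a b by (auto simp: edges_relabel)
  show "b \<notin> edges (map (relabel (id(b := a))) D)"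
    using assms(1) by (auto simp: edges_relabel)
qed

text \<open>
  The retraction \<open>\<rho>\<close> sends each of the two darts at the joint to the far end of the other edge, which precedes
  it on its face.  So the walks along faces and components correspond, while one vertex and one edge
  are lost.
\<close>

lemma planar_remove_joint:
  assumes ab: "a \<noteq> b" and cl: "paired_ends (Joint a b # D)"
  shows "planar (map (relabel (id(b := a))) D) \<longleftrightarrow> planar (Joint a b # D)"
proof -
  define F where "F = Joint a b # D"
  define E where "E = map (relabel (id(b := a))) D"
  define x where "x = opposite F (0, 0)"
  define y where "y = opposite F (0, 1)"
  define \<rho> where "\<rho> d = (if d = (0, 0) then unshift y else if d = (0, 1) then unshift x else unshift d)" for d
  note rj = paired_ends_remove_joint[OF ab cl]
  have clF: "paired_ends F" and clE: "paired_ends E" using cl rj by (auto simp: F_def E_def)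
  have dE: "darts E = darts D" by (simp add: E_def darts_relabel)
  have J: "(0, 0) \<in> darts F" "(0, 1) \<in> darts F" "label F (0, 0) = a" "label F (0, 1) = b"
    by (auto simp: F_def mem_darts label_def)
  have rotJ: "rotate_dart F (0, 0) = (0, 1)" "rotate_dart F (0, 1) = (0, 0)"
    by (auto simp: F_def rotate_dart_def)
  have rot: "rotate_dart F (shift d) = shift (rotate_dart E d)" if "d \<in> darts E" for d
    using that unfolding dE by (simp add: F_def E_def rotate_dart_relabel)
  have lab: "label E d = (id(b := a)) (label F (shift d))" if "d \<in> darts E" for d
    using that unfolding dE by (simp add: F_def E_def label_relabel)
  have cases: "d = (0, 0) \<or> d = (0, 1) \<or> (\<exists>d'\<in>darts E. d = shift d')" if "d \<in> darts F" for d
    using that unfolding F_def dE by (auto elim!: dart_Cons_cases simp: less_Suc_eq)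
  have shift: "shift d \<in> darts F" "shift d \<noteq> (0, s)" if "d \<in> darts E" for d s
    using that by (auto simp: dE F_def) (simp add: shift_def)
  have x: "x \<in> darts F" "label F x = a" "x \<noteq> (0, 0)" "x \<noteq> (0, 1)" "opposite F x = (0, 0)"
    using opposite[OF clF J(1)] J ab opposite_opposite[OF clF J(1)] by (auto simp: x_def)
  have y: "y \<in> darts F" "label F y = b" "y \<noteq> (0, 1)" "y \<noteq> (0, 0)" "opposite F y = (0, 1)"
    using opposite[OF clF J(2)] J ab opposite_opposite[OF clF J(2)] by (auto simp: y_def)
  obtain x' y' where x': "x' \<in> darts E" "x = shift x'" and y': "y' \<in> darts E" "y = shift y'"
    using cases[OF x(1)] cases[OF y(1)] x y by auto
  have \<rho>: "\<rho> (0, 0) = y'" "\<rho> (0, 1) = x'" "\<And>d. d \<in> darts E \<Longrightarrow> \<rho> (shift d) = d"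
    using x' y' shift by (auto simp: \<rho>_def)
  have \<rho>x: "\<rho> x = x'" "\<rho> y = y'"
    unfolding x'(2) y'(2) by (rule \<rho>(3)[OF x'(1)], rule \<rho>(3)[OF y'(1)])
  have opp_cases: "(d = x' \<and> opposite F (shift d) = (0, 0)) \<or> (d = y' \<and> opposite F (shift d) = (0, 1)) \<or>
      (\<exists>d'\<in>darts E. opposite F (shift d) = shift d')" if "d \<in> darts E" for d
  proof -
    have "shift d \<in> darts F" using that shift by blast
    then have o: "opposite F (shift d) \<in> darts F" "opposite F (opposite F (shift d)) = shift d"
      using opposite[OF clF] opposite_opposite[OF clF] by blast+
    from cases[OF o(1)] show ?thesis
    proof (elim disjE)
      assume "opposite F (shift d) = (0, 0)"
      then show ?thesis using o(2) x' by (simp add: x_def)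
    next
      assume "opposite F (shift d) = (0, 1)"
      then show ?thesis using o(2) y' by (simp add: y_def)
    qed blast
  qed
  have oppE: "opposite E d = \<rho> (opposite F (shift d))" if d: "d \<in> darts E" for d
  proof (rule opposite_eqI[OF clE d])
    let ?o = "opposite F (shift d)"
    have sd: "shift d \<in> darts F" using d shift by blast
    note o = opposite[OF clF sd]
    have lx: "label E x' = a" "label E y' = a"
      using x' y' x y lab ab by simp_all
    have xy: "x' \<noteq> y'" using x(2) y(2) x' y' ab by auto
    from opp_cases[OF d] show "\<rho> ?o \<in> darts E" using \<rho> x' y' by auto
    from opp_cases[OF d] show "\<rho> ?o \<noteq> d" using \<rho> x' y' xy o(2) by auto
    from opp_cases[OF d] show "label E (\<rho> ?o) = label E d"
    proof (elim disjE)
      assume "\<exists>d'\<in>darts E. opposite F (shift d) = shift d'"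
      then obtain d' where "d' \<in> darts E" "?o = shift d'" by blast
      then show ?thesis using o(3) d by (simp add: \<rho> lab)
    qed (use \<rho> lx in auto)
  qed
  have oppxy: "opposite E x' = y'" "opposite E y' = x'"
    using oppE x' y' x y \<rho> by simp_all
  let ?\<F> = "eq_closure (face_rel F)" and ?\<E> = "eq_closure (face_rel E)"
  note fF = face_stepI[of _ F] and fE = face_stepI[of _ E]
  have steps: "face_step F x = (0, 1)" "face_step F y = (0, 0)"
      "face_step F (0, 0) = shift (face_step E y')" "face_step F (0, 1) = shift (face_step E x')"
    unfolding face_step_def x(5) y(5) rotJ x_def[symmetric] y_def[symmetric] oppxy
    by (simp_all add: rot[OF x'(1), folded x'(2)] rot[OF y'(1), folded y'(2)])
  have step: "face_step F (shift d) = shift (face_step E d)"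
    if "d \<in> darts E" "d' \<in> darts E" "opposite F (shift d) = shift d'" for d d'
    using that oppE[of d] \<rho>(3) rot by (simp add: face_step_def)
  have inE: "face_step E d \<in> darts E" if "d \<in> darts E" for d
    using that face_step_in_darts[OF clE] by blast
  have "card (faces F) = card (faces E)"
    unfolding faces_eq
  proof (rule card_quotient_eq[where f = \<rho> and g = shift, OF finite_darts finite_darts])
    show "\<rho> ` darts F \<subseteq> darts E" using cases \<rho> x' y' by fastforce
    show "shift ` darts E \<subseteq> darts F" using shift by blast
    show "(\<rho> p, \<rho> q) \<in> ?\<E>" if pq: "(p, q) \<in> face_rel F" for p q
    proof -
      have p: "p \<in> darts F" "q = face_step F p" using pq by (auto simp: face_rel_def)
      from cases[OF p(1)] show ?thesis
      proof (elim disjE bexE)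
        fix d assume d: "d \<in> darts E" "p = shift d"
        from opp_cases[OF d(1)] show ?thesis
        proof (elim disjE bexE)
          fix d' assume "d' \<in> darts E" "opposite F (shift d) = shift d'"
          then show ?thesis using step d p fE \<rho>(3) inE by simp
        qed (use d p steps x' y' \<rho> in auto)
      qed (use p steps x' y' \<rho> inE fE in auto)
    qed
    show "(shift p, shift q) \<in> ?\<F>" if pq: "(p, q) \<in> face_rel E" for p q
    proof -
      have p: "p \<in> darts E" "q = face_step E p" using pq by (auto simp: face_rel_def)
      from opp_cases[OF p(1)] show ?thesis
      proof (elim disjE bexE)
        assume "p = x' \<and> opposite F (shift p) = (0, 0)"
        then show ?thesis
          using fF[OF x(1)] fF[OF J(2)] steps p x' eq_closure_trans by metis
      next
        assume "p = y' \<and> opposite F (shift p) = (0, 1)"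
        then show ?thesis
          using fF[OF y(1)] fF[OF J(1)] steps p y' eq_closure_trans by metis
      next
        fix d' assume "d' \<in> darts E" "opposite F (shift p) = shift d'"
        then show ?thesis using step p fF[of "shift p"] shift by simp
      qed
    qed
    show "(shift (\<rho> p), p) \<in> ?\<F>" if "p \<in> darts F" for p
      using cases[OF that] \<rho> x' y' fF[OF x(1)] fF[OF y(1)] steps by auto
    show "(\<rho> (shift p), p) \<in> ?\<E>" if "p \<in> darts E" for p
      using \<rho> that by simp
  qed
  let ?\<F>c = "eq_closure (component_rel F)" and ?\<E>c = "eq_closure (component_rel E)"
  note oF = component_oppositeI[of _ F] and rF = component_rotateI[of _ F]
  note oE = component_oppositeI[of _ E] and rE = component_rotateI[of _ E]
  have xJ: "(x, (0, 0)) \<in> ?\<F>c" "(y, (0, 1)) \<in> ?\<F>c" "((0, 0), (0, 1)) \<in> ?\<F>c"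
    using oF[OF x(1)] oF[OF y(1)] rF[OF J(1)] x y rotJ by simp_all
  have xy: "(x, (0, 1)) \<in> ?\<F>c" "(y, (0, 0)) \<in> ?\<F>c" "(x, y) \<in> ?\<F>c" "(y, x) \<in> ?\<F>c"
    using xJ by (meson eq_closure_sym eq_closure_trans)+
  have "card (components F) = card (components E)"
    unfolding components_eq
  proof (rule card_quotient_eq[where f = \<rho> and g = shift, OF finite_darts finite_darts])
    show "\<rho> ` darts F \<subseteq> darts E" using cases \<rho> x' y' by fastforce
    show "shift ` darts E \<subseteq> darts F" using shift by blast
    show "(\<rho> p, \<rho> q) \<in> ?\<E>c" if pq: "(p, q) \<in> component_rel F" for p q
    proof -
      have p: "p \<in> darts F" "q = opposite F p \<or> q = rotate_dart F p"
        using pq by (auto simp: component_rel_def)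
      have E: "(x', y') \<in> ?\<E>c" "(y', x') \<in> ?\<E>c" using oE x' y' oppxy by metis+
      from cases[OF p(1)] show ?thesis
      proof (elim disjE bexE)
        fix d assume d: "d \<in> darts E" "p = shift d"
        then show ?thesis
          using p(2) oppE[OF d(1)] rot[OF d(1)] \<rho>(3)[OF d(1)] oE[OF d(1)] rE[OF d(1)]
            \<rho>(3)[OF rotate_dart_in_darts[OF d(1)]] by auto
      next
        assume "p = (0, 0)"
        then have "q = x \<or> q = (0, 1)" using p(2) rotJ(1) x_def by metis
        then show ?thesis using \<open>p = (0, 0)\<close> E \<rho>(1,2) \<rho>x by metis
      next
        assume "p = (0, 1)"
        then have "q = y \<or> q = (0, 0)" using p(2) rotJ(2) y_def by metis
        then show ?thesis using \<open>p = (0, 1)\<close> E \<rho>(1,2) \<rho>x by metis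
      qed
    qed
    show "(shift p, shift q) \<in> ?\<F>c" if pq: "(p, q) \<in> component_rel E" for p q
    proof -
      have p: "p \<in> darts E" "q = opposite E p \<or> q = rotate_dart E p"
        using pq by (auto simp: component_rel_def)
      have sp: "shift p \<in> darts F" using shift p by blast
      show ?thesis
      proof (cases "q = rotate_dart E p")
        case True
        then show ?thesis using rF[OF sp] rot[OF p(1)] by simp
      next
        case False
        then have q: "q = \<rho> (opposite F (shift p))" using p oppE by auto
        from opp_cases[OF p(1)] show ?thesis
        proof (elim disjE bexE)
          fix d' assume "d' \<in> darts E" "opposite F (shift p) = shift d'"
          then show ?thesis using q \<rho>(3) oF[OF sp] by simp
        qed (use q \<rho> xy x' y' in auto)
      qed
    qed
    show "(shift (\<rho> p), p) \<in> ?\<F>c" if "p \<in> darts F" for p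
      using cases[OF that] \<rho> x' y' xy by auto
    show "(\<rho> (shift p), p) \<in> ?\<E>c" if "p \<in> darts E" for p
      using \<rho> that by simp
  qed
  moreover have "card (edges F) = Suc (card (edges E))"
  proof -
    have "finite (edges E)" by (simp add: edges_def)
    then show ?thesis using rj(2,3) unfolding F_def E_def by simp
  qed
  moreover have "length F = Suc (length E)" by (simp add: F_def E_def)
  ultimately have "planar E \<longleftrightarrow> planar F"
    using \<open>card (faces F) = card (faces E)\<close> by (simp add: planar_def)
  then show ?thesis by (simp add: E_def F_def)
qed

lemma remove_joint_link_diagram:
  assumes "a \<noteq> b" "link_diagram (Joint a b # D)"
  shows "link_diagram (map (relabel (id(b := a))) D)"
proof -
  have cl: "paired_ends (Joint a b # D)" using assms(2) by (simp add: link_diagram_iff)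
  have "D \<noteq> []" using paired_ends_remove_joint(4)[OF assms(1) cl] by auto
  then show ?thesis
    using assms paired_ends_remove_joint(1)[OF assms(1) cl] planar_remove_joint[OF assms(1) cl]
    by (simp add: link_diagram_iff)
qed

lemma is_crossing_relabel [simp]: "is_crossing (relabel \<rho> v) = is_crossing v"
  by (cases v) auto

lemma shift_in_crossing_darts [simp]: "shift d \<in> crossing_darts (v # D) \<longleftrightarrow> d \<in> crossing_darts D"
  by (simp add: crossing_darts_def) (simp add: shift_def)

lemma crossing_darts_relabel [simp]: "crossing_darts (map (relabel \<rho>) D) = crossing_darts D"
  unfolding crossing_darts_def darts_relabel by (auto simp: darts_def)

lemma remove_joint_alternating:
  assumes alt: "alternating_diagram (Joint a b # D)"
  shows "alternating_diagram (map (relabel (id(b := a))) D)"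
proof -
  define F where "F = Joint a b # D"
  define \<rho> where "\<rho> = id(b := a)"
  define E where "E = map (relabel \<rho>) D"
  have \<rho>: "(x, \<rho> x) \<in> segment_rel F" for x
    unfolding segment_rel_def F_def
    by (cases "x = b") (auto simp: \<rho>_def intro!: eq_closure_sym[OF eq_closure_base])
  have Joint_E: "\<exists>p q. Joint p q \<in> set D \<and> x = \<rho> p \<and> y = \<rho> q" if xy: "Joint x y \<in> set E" for x y
  proof -
    obtain v where v: "v \<in> set D" "Joint x y = relabel \<rho> v" using xy by (auto simp: E_def)
    then show ?thesis by (cases v rule: vertex.exhaust) auto
  qed
  have seg: "(x, y) \<in> segment_rel F" if "(\<rho> x, \<rho> y) \<in> segment_rel E" for x y
  proof -
    have "(id (\<rho> x), id (\<rho> y)) \<in> segment_rel F"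
      unfolding segment_rel_def[of F]
    proof (rule eq_closure_map[OF that[unfolded segment_rel_def]])
      fix u v assume "(u, v) \<in> {(a, b). Joint a b \<in> set E}"
      then obtain p q where pq: "Joint p q \<in> set D" "u = \<rho> p" "v = \<rho> q" using Joint_E by blast
      then have "(p, q) \<in> segment_rel F" by (auto simp: segment_rel_def F_def intro!: eq_closure_base)
      then show "(id u, id v) \<in> eq_closure {(a, b). Joint a b \<in> set F}"
        using \<rho>[of p] \<rho>[of q] pq unfolding segment_rel_def
        by (auto intro: eq_closure_sym eq_closure_trans)
    qed
    then show ?thesis
      using \<rho>[of x] \<rho>[of y] unfolding segment_rel_def
      by (auto intro: eq_closure_sym eq_closure_trans)
  qed
  have "alternating_diagram E"
    unfolding alternating_diagram_def
  proof (intro ballI impI)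
    fix d d'
    assume d: "d \<in> crossing_darts E" "d' \<in> crossing_darts E"
      and dd: "d \<noteq> d' \<and> (label E d, label E d') \<in> segment_rel E"
    have D: "d \<in> darts D" "d' \<in> darts D" using d by (simp_all add: E_def crossing_darts_def[of D])
    then have "(label D d, label D d') \<in> segment_rel F"
      using dd seg by (simp add: E_def label_relabel)
    moreover have "shift d \<in> crossing_darts F" "shift d' \<in> crossing_darts F"
      using d by (simp_all add: E_def F_def)
    ultimately have "odd (snd (shift d)) \<noteq> odd (snd (shift d'))"
      using alt dd unfolding alternating_diagram_def F_def by (metis label_shift shift_eq_iff)
    then show "odd (snd d) \<noteq> odd (snd d')" by (simp add: shift_def)
  qed
  then show ?thesis by (simp add: E_def \<rho>_def)
qed

section \<open>Removing kinks\<close>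

lemma paired_ends_R1:
  assumes "ends v = [k, k, a, b]" and "paired_ends (v # D)"
  shows "paired_ends (Joint a b # D)" "edges (v # D) = insert k (edges (Joint a b # D))"
    "k \<notin> edges (Joint a b # D)"
proof -
  have "k \<notin> set ([a, b] @ all_ends D)"
    by (rule paired_ends_twiceD[OF assms(2)]) (simp add: all_ends_Cons assms(1))
  then show k: "k \<notin> edges (Joint a b # D)" by (simp add: edges_def all_ends_Cons)
  show e: "edges (v # D) = insert k (edges (Joint a b # D))" by (auto simp: assms(1))
  have "count_list (all_ends (v # D)) e = count_list (all_ends (Joint a b # D)) e"
    if "e \<noteq> k" for e
    using that by (auto simp: all_ends_Cons assms(1))
  then show "paired_ends (Joint a b # D)"
    using assms(2) k e unfolding paired_ends_def by (metis insertI2)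
qed

text \<open>
  In position order the darts of the crossing are \<open>p, m\<close> (the two ends of the kink) and \<open>c, d\<close>.  The dart
  \<open>m\<close> is a face by itself, and \<open>p\<close> is followed by \<open>c\<close> on its face.  Retracting \<open>p\<close> and \<open>m\<close> to \<open>c\<close>
  therefore matches all other faces and all components: one edge and one face are lost.
\<close>

lemma planar_R1:
  assumes v: "ends v = [k, k, a, b]" and cl: "paired_ends (v # D)"
  shows "planar (Joint a b # D) \<longleftrightarrow> planar (v # D)"
proof -
  define F where "F = v # D"
  define E where "E = Joint a b # D"
  define \<iota> :: "nat \<times> nat \<Rightarrow> nat \<times> nat" where "\<iota> d = (if fst d = 0 then (0, snd d + 2) else d)" for d
  define \<rho> :: "nat \<times> nat \<Rightarrow> nat \<times> nat" where "\<rho> d = (if fst d = 0 then (0, snd d - 2) else d)" for d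
  have clF: "paired_ends F" and clE: "paired_ends E" and kE: "k \<notin> edges E"
    using cl paired_ends_R1[OF v cl] by (simp_all add: F_def E_def)
  let ?p = "(0::nat, 0::nat)" and ?m = "(0::nat, 1::nat)" and ?c = "(0::nat, 2::nat)" and ?d = "(0::nat, 3::nat)"
  have \<rho>_simps: "\<rho> ?p = ?p" "\<rho> ?m = ?p" "\<rho> ?c = ?p" "\<rho> ?d = ?m"
      "\<iota> ?p = ?c" "\<iota> ?m = ?d"
    by (simp_all add: \<rho>_def \<iota>_def)
  have sh: "\<rho> (shift d) = shift d" "\<iota> (shift d) = shift d" for d by (simp_all add: \<rho>_def \<iota>_def shift_def)
  have casesF: "d = ?p \<or> d = ?m \<or> d = ?c \<or> d = ?d \<or> (\<exists>d'\<in>darts D. d = shift d')" if "d \<in> darts F" for d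
    using that unfolding F_def by (auto elim!: dart_Cons_cases simp: v less_Suc_eq)
  have casesE: "d = ?p \<or> d = ?m \<or> (\<exists>d'\<in>darts D. d = shift d')" if "d \<in> darts E" for d
    using that unfolding E_def by (auto elim!: dart_Cons_cases simp: less_Suc_eq)
  have headF: "?p \<in> darts F" "?m \<in> darts F" "?c \<in> darts F" "?d \<in> darts F"
    and headE: "?p \<in> darts E" "?m \<in> darts E"
    by (simp_all add: F_def E_def mem_darts v)
  have shF: "shift d \<in> darts F" and shE: "shift d \<in> darts E" if "d \<in> darts D" for d
    using that by (simp_all add: F_def E_def)
  have rotF: "rotate_dart F ?p = ?m" "rotate_dart F ?m = ?c" "rotate_dart F ?c = ?d" "rotate_dart F ?d = ?p"
    and rotE: "rotate_dart E ?p = ?m" "rotate_dart E ?m = ?p"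
    by (simp_all add: F_def E_def rotate_dart_def v)
  have labF: "label F ?p = k" "label F ?m = k" "label F ?c = a" "label F ?d = b"
    and labE: "label E ?p = a" "label E ?m = b"
    by (simp_all add: F_def E_def label_def v)
  have oppF: "opposite F ?p = ?m" "opposite F ?m = ?p"
    by (rule opposite_eqI[OF clF headF(1,2)], simp, simp only: labF)
      (rule opposite_eqI[OF clF headF(2,1)], simp, simp only: labF)
  have sh_ne: "shift d \<noteq> ?p" "shift d \<noteq> ?m" for d by (simp_all add: shift_def)
  have rotsh: "rotate_dart F (shift d) = shift (rotate_dart D d)"
      "rotate_dart E (shift d) = shift (rotate_dart D d)" for d
    by (simp_all add: F_def E_def)
  have labsh: "label F (shift d) = label E (shift d)" for d by (simp add: F_def E_def)
  have \<iota>: "label F (\<iota> d) = label E d \<and> \<iota> d \<in> darts F \<and> \<iota> d \<noteq> ?p \<and> \<iota> d \<noteq> ?m \<and> \<rho> (\<iota> d) = d"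
    if "d \<in> darts E" for d
    using casesE[OF that]
  proof (elim disjE bexE)
    assume d: "d = ?p"
    show ?thesis unfolding d \<rho>_simps labF labE using headF(3) by simp
  next
    assume d: "d = ?m"
    show ?thesis unfolding d \<rho>_simps labF labE using headF(4) by simp
  next
    fix d' assume d: "d' \<in> darts D" "d = shift d'"
    show ?thesis unfolding d(2) sh labsh using sh_ne shF[OF d(1)] by blast
  qed
  note lab\<iota> = \<iota>[THEN conjunct1] and \<iota>F = \<iota>[THEN conjunct2, THEN conjunct1]
    \<iota>[THEN conjunct2, THEN conjunct2, THEN conjunct1]
    \<iota>[THEN conjunct2, THEN conjunct2, THEN conjunct2, THEN conjunct1]
    and \<rho>\<iota> = \<iota>[THEN conjunct2, THEN conjunct2, THEN conjunct2, THEN conjunct2]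
  have \<rho>E: "\<rho> d \<in> darts E" if "d \<in> darts F" for d
    using casesF[OF that] headE shE by (elim disjE bexE) (simp_all only: \<rho>_simps sh)
  have \<iota>\<rho>: "\<iota> (\<rho> d) = d" if "d \<in> darts F" "d \<noteq> ?p" "d \<noteq> ?m" for d
    using casesF[OF that(1)] that(2,3) by (elim disjE bexE) (simp_all only: \<rho>_simps sh simp_thms)
  have opp_ne: "opposite F d \<noteq> ?p" "opposite F d \<noteq> ?m" if "d \<in> darts F" "d \<noteq> ?p" "d \<noteq> ?m" for d
    using opposite_opposite[OF clF that(1)] that oppF by metis+
  have rot\<rho>: "\<rho> (rotate_dart F d) = rotate_dart E (\<rho> d)" if "d \<in> darts F" "d \<noteq> ?p" "d \<noteq> ?m" for d
    using casesF[OF that(1)] that(2,3)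
    by (elim disjE bexE) (simp_all only: \<rho>_simps rotF rotE sh rotsh simp_thms)
  have oppE: "opposite E d = \<rho> (opposite F (\<iota> d))" if d: "d \<in> darts E" for d
  proof (rule opposite_eqI[OF clE d])
    let ?o = "opposite F (\<iota> d)"
    note o = opposite[OF clF \<iota>F(1)[OF d]] and one = opp_ne[OF \<iota>F[OF d]]
    show "\<rho> ?o \<in> darts E" by (rule \<rho>E[OF o(1)])
    show "\<rho> ?o \<noteq> d" using \<iota>\<rho>[OF o(1) one] o(2) by metis
    show "label E (\<rho> ?o) = label E d"
      using lab\<iota>[OF \<rho>E[OF o(1)]] lab\<iota>[OF d] \<iota>\<rho>[OF o(1) one] o(3) by simp
  qed
  have opp\<rho>: "\<rho> (opposite F d) = opposite E (\<rho> d)" if d: "d \<in> darts F" "d \<noteq> ?p" "d \<noteq> ?m" for d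
    using oppE[OF \<rho>E[OF d(1)]] \<iota>\<rho>[OF d] by simp
  have rot_m: "d = ?p" if "d \<in> darts F" "rotate_dart F d = ?m" for d
    using casesF[OF that(1)] that(2)
    by (elim disjE bexE) (simp_all only: rotF rotsh sh_ne simp_thms, simp_all)
  have step_head: "face_step F ?p = ?c" "face_step F ?m = ?m"
    by (simp_all only: face_step_def oppF rotF)
  have step_m: "face_step F d = ?m \<longleftrightarrow> d = ?m" if "d \<in> darts F" for d
  proof
    assume "face_step F d = ?m"
    then have "opposite F d = ?p"
      using rot_m opposite(1)[OF clF that] unfolding face_step_def by blast
    then show "d = ?m" using opposite_opposite[OF clF that] oppF by simp
  qed (simp only: step_head)
  have step\<rho>: "\<rho> (face_step F d) = face_step E (\<rho> d)" if d: "d \<in> darts F" "d \<noteq> ?p" "d \<noteq> ?m" for d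
    unfolding face_step_def using rot\<rho>[OF opposite(1)[OF clF d(1)] opp_ne[OF d]] opp\<rho>[OF d] by simp
  define X where "X = darts F - {?m}"
  let ?\<F> = "eq_closure (face_rel F)" and ?\<E> = "eq_closure (face_rel E)"
  have face_\<iota>\<rho>: "(\<iota> (\<rho> z), z) \<in> ?\<F>" if "z \<in> X" for z
  proof (cases "z = ?p")
    case True
    then show ?thesis
      using eq_closure_sym[OF face_stepI[OF headF(1)]] by (simp only: \<rho>_simps step_head)
  next
    case False
    then show ?thesis using \<iota>\<rho>[of z] that by (simp add: X_def)
  qed
  have "card (X // ?\<F>) = card (darts E // ?\<E>)"
  proof (rule card_quotient_eq[where f = \<rho> and g = \<iota>])
    show "finite X" "finite (darts E)" by (simp_all add: X_def finite_darts)
    show "\<rho> ` X \<subseteq> darts E" unfolding X_def using \<rho>E by blast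
    show "\<iota> ` darts E \<subseteq> X"
      by (rule image_subsetI) (simp only: X_def Diff_iff singleton_iff \<iota>F simp_thms)
    show "(\<rho> x, \<rho> y) \<in> ?\<E>" if xy: "(x, y) \<in> face_rel F" for x y
    proof -
      have x: "x \<in> darts F" "y = face_step F x" using xy by (auto simp: face_rel_def)
      consider "x = ?p" | "x = ?m" | "x \<noteq> ?p" "x \<noteq> ?m" by blast
      then show ?thesis
      proof cases
        case 1 then show ?thesis unfolding x(2) by (simp only: step_head \<rho>_simps eq_closure_refl)
      next
        case 2 then show ?thesis unfolding x(2) by (simp only: step_head \<rho>_simps eq_closure_refl)
      next
        case 3 then show ?thesis using step\<rho>[OF x(1) 3] face_stepI[OF \<rho>E[OF x(1)]] x(2) by simp
      qed
    qed
    show "(\<iota> x, \<iota> y) \<in> ?\<F>" if xy: "(x, y) \<in> face_rel E" for x y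
    proof -
      have x: "x \<in> darts E" "y = face_step E x" using xy by (auto simp: face_rel_def)
      note ix = \<iota>F[OF x(1)]
      have "y = \<rho> (face_step F (\<iota> x))" using step\<rho>[OF ix] \<rho>\<iota>[OF x(1)] x(2) by simp
      moreover have "face_step F (\<iota> x) \<in> X"
        using face_step_in_darts[OF clF ix(1)] step_m[OF ix(1)] ix(3) by (simp add: X_def)
      ultimately show ?thesis
        using face_stepI[OF ix(1)] eq_closure_sym[OF face_\<iota>\<rho>] eq_closure_trans by metis
    qed
    show "(\<iota> (\<rho> x), x) \<in> ?\<F>" if "x \<in> X" for x using face_\<iota>\<rho>[OF that] .
    show "(\<rho> (\<iota> x), x) \<in> ?\<E>" if "x \<in> darts E" for x using \<rho>\<iota>[OF that] by simp
  qed
  moreover have "card (insert ?m X // ?\<F>) = Suc (card (X // ?\<F>))"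
  proof (rule card_quotient_insert_singleton_class)
    fix x assume x: "(?m, x) \<in> ?\<F>"
    have "(?m = ?m) = (x = ?m)"
    proof (rule eq_closure_invariant[OF x, where f = "\<lambda>d. d = ?m"])
      fix d e assume "(d, e) \<in> face_rel F"
      then have "d \<in> darts F" "e = face_step F d" by (auto simp: face_rel_def)
      then show "(d = ?m) = (e = ?m)" using step_m[of d] by simp
    qed
    then show "x = ?m" by simp
  qed (auto simp: X_def finite_darts)
  moreover have "insert ?m X = darts F" using headF by (auto simp: X_def)
  ultimately have faces: "card (faces F) = Suc (card (faces E))" by (simp add: faces_eq)
  let ?\<F>c = "eq_closure (component_rel F)" and ?\<E>c = "eq_closure (component_rel E)"
  have head_comp: "(?m, ?c) \<in> ?\<F>c" "(?p, ?m) \<in> ?\<F>c"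
    using component_rotateI[OF headF(2)] component_rotateI[OF headF(1)] by (simp_all only: rotF)
  have comp_\<iota>\<rho>: "(\<iota> (\<rho> z), z) \<in> ?\<F>c" if "z \<in> darts F" for z
  proof -
    consider "z = ?p" | "z = ?m" | "z \<noteq> ?p" "z \<noteq> ?m" by blast
    then show ?thesis
    proof cases
      case 1
      have "(?c, ?p) \<in> ?\<F>c" using head_comp by (meson eq_closure_sym eq_closure_trans)
      then show ?thesis unfolding 1 by (simp only: \<rho>_simps)
    next
      case 2
      have "(?c, ?m) \<in> ?\<F>c" using head_comp by (meson eq_closure_sym)
      then show ?thesis unfolding 2 by (simp only: \<rho>_simps)
    next
      case 3
      then show ?thesis using \<iota>\<rho>[OF that] by simp
    qed
  qed
  have "card (components F) = card (components E)"
    unfolding components_eq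
  proof (rule card_quotient_eq[where f = \<rho> and g = \<iota>, OF finite_darts finite_darts])
    show "\<rho> ` darts F \<subseteq> darts E" using \<rho>E by blast
    show "\<iota> ` darts E \<subseteq> darts F" using \<iota>F by blast
    show "(\<rho> x, \<rho> y) \<in> ?\<E>c" if xy: "(x, y) \<in> component_rel F" for x y
    proof -
      have x: "x \<in> darts F" and y: "y = opposite F x \<or> y = rotate_dart F x"
        using xy by (auto simp: component_rel_def)
      consider "x = ?p" | "x = ?m" | "x \<noteq> ?p" "x \<noteq> ?m" by blast
      then show ?thesis
      proof cases
        case 1
        then have "y = ?m" using y oppF rotF by metis
        then show ?thesis unfolding 1 by (simp only: \<rho>_simps eq_closure_refl)
      next
        case 2
        then have "y = ?p \<or> y = ?c" using y oppF rotF by metis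
        then show ?thesis unfolding 2 by (elim disjE) (simp_all only: \<rho>_simps eq_closure_refl)
      next
        case 3
        then have "\<rho> y = opposite E (\<rho> x) \<or> \<rho> y = rotate_dart E (\<rho> x)"
          using y opp\<rho>[OF x] rot\<rho>[OF x] by metis
        then show ?thesis
          using component_oppositeI[OF \<rho>E[OF x]] component_rotateI[OF \<rho>E[OF x]] by metis
      qed
    qed
    show "(\<iota> x, \<iota> y) \<in> ?\<F>c" if xy: "(x, y) \<in> component_rel E" for x y
    proof -
      have x: "x \<in> darts E" and y: "y = opposite E x \<or> y = rotate_dart E x"
        using xy by (auto simp: component_rel_def)
      note ix = \<iota>F[OF x]
      have "y = \<rho> (opposite F (\<iota> x)) \<or> y = \<rho> (rotate_dart F (\<iota> x))"
        using y oppE[OF x] rot\<rho>[OF ix] \<rho>\<iota>[OF x] by metis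
      then show ?thesis
        using comp_\<iota>\<rho>[OF opposite(1)[OF clF ix(1)]] comp_\<iota>\<rho>[OF rotate_dart_in_darts[OF ix(1)]]
          component_oppositeI[OF ix(1)] component_rotateI[OF ix(1)]
        by (metis eq_closure_sym eq_closure_trans)
    qed
    show "(\<iota> (\<rho> x), x) \<in> ?\<F>c" if "x \<in> darts F" for x using comp_\<iota>\<rho>[OF that] .
    show "(\<rho> (\<iota> x), x) \<in> ?\<E>c" if "x \<in> darts E" for x using \<rho>\<iota>[OF that] by simp
  qed
  moreover have "card (edges F) = Suc (card (edges E))"
  proof -
    have "finite (edges E)" by (simp add: edges_def)
    then show ?thesis using paired_ends_R1(2,3)[OF v cl] unfolding F_def E_def by simp
  qed
  ultimately show ?thesis
    using faces by (simp add: planar_def E_def F_def)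
qed

lemma R1_link_diagram:
  assumes "link_diagram (Crossing k k a b # D)"
  shows "link_diagram (Joint a b # D)"
  using assms paired_ends_R1[of "Crossing k k a b" k a b D] planar_R1[of "Crossing k k a b" k a b D]
  by (simp add: link_diagram_iff)

text \<open>
  Planarity is insensitive to which strand passes over, so a quarter turn of the crossing reduces this
  kink to the other one.
\<close>

lemma R1'_link_diagram:
  assumes "link_diagram (Crossing a k k b # D)"
  shows "link_diagram (Joint a b # D)"
proof -
  have "link_diagram (Crossing k k b a # D)"
    using assms rotate_head[of "Crossing k k b a" "Crossing a k k b" D] by (simp add: link_diagram_iff)
  then have "link_diagram (Joint b a # D)" by (rule R1_link_diagram)
  then show ?thesis
    using rotate_head[of "Joint a b" "Joint b a" D] by (simp add: link_diagram_iff)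
qed

text \<open>
  The new joint connects the over-end and the under-end that leave the kink, so the two passages that
  it makes consecutive have opposite parity.  Without other joints, segments in the new diagram are single
  edges or consist of these two edges.
\<close>

lemma R1_alternating:
  assumes v: "v = Crossing k k a b \<or> v = Crossing a k k b"
    and cl: "paired_ends (v # D)" and alt: "alternating_diagram (v # D)"
    and red: "\<And>p q. Joint p q \<in> set D \<Longrightarrow> p = q"
  shows "alternating_diagram (Joint a b # D)"
proof -
  let ?F = "v # D" and ?E = "Joint a b # D"
  obtain s t where st: "(0, s) \<in> darts ?F" "(0, t) \<in> darts ?F" "label ?F (0, s) = a" "label ?F (0, t) = b"
    "odd s \<noteq> odd t"
  proof (cases "v = Crossing k k a b")
    case True
    then show thesis by (intro that[of 2 3]) (auto simp: mem_darts label_def)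
  next
    case False
    then show thesis using v by (intro that[of 0 3]) (auto simp: mem_darts label_def)
  qed
  have cv: "is_crossing v" using v by auto
  have seg: "x = y \<or> (x = a \<and> y = b) \<or> (x = b \<and> y = a)" if xy: "(x, y) \<in> segment_rel ?E" for x y
  proof -
    have "(if x = b then a else x) = (if y = b then a else y)"
      by (rule eq_closure_invariant[OF xy[unfolded segment_rel_def]]) (auto dest: red)
    then show ?thesis by (auto split: if_splits)
  qed
  have parity: "odd (snd d) \<noteq> odd (snd d')"
    if "d \<in> crossing_darts ?F" "d' \<in> crossing_darts ?F" "d \<noteq> d'" "label ?F d = label ?F d'" for d d'
  proof -
    have "(label ?F d, label ?F d') \<in> segment_rel ?F" by (simp add: that(4) segment_rel_def)
    then show ?thesis using alt that(1-3) unfolding alternating_diagram_def by blast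
  qed
  have head: "(0, s) \<in> crossing_darts ?F" "(0, t) \<in> crossing_darts ?F"
    using st cv by (simp_all add: crossing_darts_def)
  show ?thesis
    unfolding alternating_diagram_def
  proof (intro ballI impI)
    fix d d'
    assume d: "d \<in> crossing_darts ?E" "d' \<in> crossing_darts ?E"
      and dd: "d \<noteq> d' \<and> (label ?E d, label ?E d') \<in> segment_rel ?E"
    have "\<exists>d0. d = shift d0 \<and> shift d0 \<in> crossing_darts ?F" if "d \<in> crossing_darts ?E" for d
    proof -
      have "d \<in> darts ?E" using that by (simp add: crossing_darts_def)
      then show ?thesis
      proof (cases rule: dart_Cons_cases)
        case (1 s)
        then show ?thesis using that by (simp add: crossing_darts_def)
      next
        case (2 d0)
        then show ?thesis using that by auto
      qed
    qed
    then obtain e e' where e: "d = shift e" "d' = shift e'"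
      "shift e \<in> crossing_darts ?F" "shift e' \<in> crossing_darts ?F" using d by blast
    have l: "label ?F d = label ?E d" "label ?F d' = label ?E d'" by (simp_all add: e)
    have ne: "d \<noteq> (0, r)" "d' \<noteq> (0, r)" for r by (simp_all add: e shift_def)
    from dd seg consider "label ?E d = label ?E d'" | "label ?E d = a" "label ?E d' = b"
      | "label ?E d = b" "label ?E d' = a" by blast
    then show "odd (snd d) \<noteq> odd (snd d')"
    proof cases
      case 1
      then show ?thesis using parity[of d d'] e l dd by simp
    next
      case 2
      then have "odd (snd d) \<noteq> odd s" "odd (snd d') \<noteq> odd t"
        using parity[of d "(0, s)"] parity[of d' "(0, t)"] head st l e ne by simp_all
      then show ?thesis using st(5) by blast
    next
      case 3
      then have "odd (snd d) \<noteq> odd t" "odd (snd d') \<noteq> odd s"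
        using parity[of d "(0, t)"] parity[of d' "(0, s)"] head st l e ne by simp_all
      then show ?thesis using st(5) by blast
    qed
  qed
qed

section \<open>Constant colorings force a kink\<close>

text \<open>
  The ordered universal coloring is constant along edges by the maximum principle.  Evaluating this on the
  coloring by the core of the group generated by the crossings, modulo \<open>p + q - 2 c\<close>, exhibits the
  difference of the ends of every edge as a combination of relators, that is, as a Laplacian.  The cuts
  obtained from it force a loop, which joins an over-end to an under-end of one crossing.
\<close>

lemma kink_exists:
  fixes Q :: "'q magma"
  assumes cl: "paired_ends D" and alt: "alternating_diagram D"
    and red: "\<And>p q. Joint p q \<in> set D \<Longrightarrow> p = q"
    and cross: "\<exists>v\<in>set D. is_crossing v"
    and Q: "involutory_quandle Q" and lt: "left_order_on Q lt"
    and f: "universal_coloring Q D f"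
  shows "\<exists>a b c d. Crossing a b c d \<in> set D \<and> (a = b \<or> b = c \<or> c = d \<or> d = a)"
proof -
  define V where "V = {i. i < length D \<and> is_crossing (D ! i)}"
  define Ov where "Ov = {d \<in> crossing_darts D. odd (snd d)}"
  define tgt where "tgt e = fst (opposite D e)" for e
  have V_ends: "\<exists>a b c d. D ! i = Crossing a b c d \<and> Crossing a b c d \<in> set D" if "i \<in> V" for i
  proof -
    have "D ! i \<in> set D" "is_crossing (D ! i)" using that by (auto simp: V_def)
    then show ?thesis by (cases "D ! i" rule: vertex.exhaust) auto
  qed
  have mem_cd: "(i, s) \<in> crossing_darts D \<longleftrightarrow> i \<in> V \<and> s < 4" for i s
  proof -
    have "length (ends (D ! i)) = 4" if "is_crossing (D ! i)" using that by (cases "D ! i") auto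
    then show ?thesis by (auto simp: crossing_darts_def V_def mem_darts)
  qed
  have cd_darts: "e \<in> darts D" if "e \<in> crossing_darts D" for e using that by (simp add: crossing_darts_def)
  have lt4: "s = 0 \<or> s = 1 \<or> s = 2 \<or> s = 3" if "s < 4" for s :: nat using that by auto
  have mem_O: "(i, s) \<in> Ov \<longleftrightarrow> i \<in> V \<and> (s = 1 \<or> s = 3)" for i s
    using lt4[of s] by (auto simp: Ov_def mem_cd)
  \<comment> \<open>A crossingless circle consists of one joint, whose two darts are partners of each other.\<close>
  have opp_cd: "opposite D e \<in> crossing_darts D" if e: "e \<in> crossing_darts D" for e
  proof (rule ccontr)
    assume ncd: "opposite D e \<notin> crossing_darts D"
    note o = opposite[OF cl cd_darts[OF e]]
    obtain i s where es: "opposite D e = (i, s)" by fastforce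
    have i: "i < length D" "s < length (ends (D ! i))" "\<not> is_crossing (D ! i)"
      using o(1) ncd unfolding es by (auto simp: mem_darts crossing_darts_def)
    then obtain a b where J: "D ! i = Joint a b" by (cases "D ! i") auto
    then have "a = b" using red i(1) nth_mem[of i D] by metis
    have s: "s = 0 \<or> s = 1" using i(2) J by auto
    have "opposite D (i, s) = (i, 1 - s)"
      by (rule opposite_eqI[OF cl]) (use s i J \<open>a = b\<close> in \<open>auto simp: mem_darts label_def\<close>)
    then have "e = (i, 1 - s)" using opposite_opposite[OF cl cd_darts[OF e]] es by simp
    then show False using e i(3) by (simp add: crossing_darts_def)
  qed
  have opp_par: "odd (snd (opposite D e)) \<noteq> odd (snd e)" if e: "e \<in> crossing_darts D" for e
  proof -
    note o = opposite[OF cl cd_darts[OF e]]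
    have "(label D (opposite D e), label D e) \<in> segment_rel D" by (simp add: o(3) segment_rel_def)
    then show ?thesis using alt opp_cd[OF e] e o(2) unfolding alternating_diagram_def by blast
  qed
  have opp_opp: "opposite D (opposite D e) = e" if "e \<in> crossing_darts D" for e
    using opposite_opposite[OF cl cd_darts[OF that]] .
  have opp_label: "label D (opposite D e) = label D e" if "e \<in> crossing_darts D" for e
    using opposite(3)[OF cl cd_darts[OF that]] .
  have under_cd: "(v, 0) \<in> crossing_darts D" "(v, 2) \<in> crossing_darts D" if "v \<in> V" for v
    using that by (simp_all add: mem_cd)
  have under_opp: "opposite D (v, 0) \<in> Ov" "opposite D (v, 2) \<in> Ov" if "v \<in> V" for v
    using opp_cd[OF under_cd(1)[OF that]] opp_cd[OF under_cd(2)[OF that]]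
      opp_par[OF under_cd(1)[OF that]] opp_par[OF under_cd(2)[OF that]] by (simp_all add: Ov_def)
  have O_cd: "e \<in> crossing_darts D" if "e \<in> Ov" for e using that by (simp add: Ov_def)
  have O_opp: "\<exists>v\<in>V. opposite D e = (v, 0) \<or> opposite D e = (v, 2)" if e: "e \<in> Ov" for e
  proof -
    obtain v s where vs: "opposite D e = (v, s)" by fastforce
    then have "v \<in> V" "s < 4" "even s"
      using opp_cd[OF O_cd[OF e]] opp_par[OF O_cd[OF e]] e by (auto simp: mem_cd Ov_def)
    then show ?thesis using vs lt4[of s] by auto
  qed
  have in_edges: "{e \<in> Ov. tgt e = v} = {opposite D (v, 0), opposite D (v, 2)}" if v: "v \<in> V" for v
  proof
    show "{e \<in> Ov. tgt e = v} \<subseteq> {opposite D (v, 0), opposite D (v, 2)}"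
    proof
      fix e assume e: "e \<in> {e \<in> Ov. tgt e = v}"
      then have "opposite D e = (v, 0) \<or> opposite D e = (v, 2)"
        using O_opp[of e] by (auto simp: tgt_def)
      then show "e \<in> {opposite D (v, 0), opposite D (v, 2)}" using opp_opp[of e] e O_cd by auto
    qed
    show "{opposite D (v, 0), opposite D (v, 2)} \<subseteq> {e \<in> Ov. tgt e = v}"
      using under_opp[OF v] opp_opp[OF under_cd(1)[OF v]] opp_opp[OF under_cd(2)[OF v]]
      by (simp add: tgt_def)
  qed
  have in_ne: "opposite D (v, 0) \<noteq> opposite D (v, 2)" if v: "v \<in> V" for v
    using opp_opp[OF under_cd(1)[OF v]] opp_opp[OF under_cd(2)[OF v]] by force
  \<comment> \<open>Out-edges are the over-ends of a crossing, in-edges are the partners of its under-ends.\<close>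
  interpret two_in_two_out V Ov fst tgt
  proof
    show "finite V" by (simp add: V_def)
    show "finite Ov" unfolding Ov_def crossing_darts_def using finite_darts[of D] by simp
    show "fst e \<in> V" if "e \<in> Ov" for e using that by (cases e) (simp add: mem_O)
    show "tgt e \<in> V" if "e \<in> Ov" for e using O_opp[OF that] by (auto simp: tgt_def)
    show "card {e \<in> Ov. fst e = v} = 2" if "v \<in> V" for v
    proof -
      have "{e \<in> Ov. fst e = v} = {(v, 1), (v, 3)}" using that by (auto simp: mem_O)
      then show ?thesis by simp
    qed
    show "card {e \<in> Ov. tgt e = v} = 2" if "v \<in> V" for v
      unfolding in_edges[OF that] using in_ne[OF that] by simp
  qed
  have col: "coloring Q D f" using f by (simp add: universal_coloring_def)
  define \<phi> where "\<phi> i = f (label D (i, 1))" for i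
  have crossing_col: "f (label D (v, 3)) = \<phi> v \<and> f (label D (v, 1)) = \<phi> v \<and>
      f (label D (v, 2)) = f (label D (v, 0)) \<star>\<^bsub>Q\<^esub> \<phi> v" if v: "v \<in> V" for v
  proof -
    obtain a b c d where v: "D ! v = Crossing a b c d" "Crossing a b c d \<in> set D"
      using V_ends[OF v] by blast
    then have "obeys Q f (Crossing a b c d)" using col unfolding coloring_def by blast
    then show ?thesis by (simp add: \<phi>_def label_def v)
  qed
  have label_O: "f (label D e) = \<phi> (fst e)" if "e \<in> Ov" for e
    using that crossing_col[of "fst e"] by (cases e) (auto simp: mem_O)
  have under_col: "f (label D (v, s)) = \<phi> (fst (opposite D (v, s)))"
    if v: "v \<in> V" "s = 0 \<or> s = 2" for v s
    using label_O[of "opposite D (v, s)"] under_opp[OF v(1)] under_cd[OF v(1)] opp_label v(2) by auto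
  have \<phi>_el: "\<phi> v \<in> elems Q" if "v \<in> V" for v
    using col label_in_edges[of "(v, 1)" D] cd_darts[of "(v, 1)"] that
    by (simp add: \<phi>_def coloring_def mem_cd)
  have const: "\<phi> (fst e) = \<phi> (tgt e)" if "e \<in> Ov" for e
  proof (rule constant_on_edges_if_between[where lt = lt and A = "elems Q"])
    show "irreflp_on (elems Q) lt" "transp_on (elems Q) lt" "totalp_on (elems Q) lt"
      using lt by (simp_all add: left_order_on_def)
    show "\<phi> v \<in> elems Q" if "v \<in> V" for v using \<phi>_el[OF that] .
    show "e \<in> Ov" by fact
    fix e assume e: "e \<in> Ov" and less: "lt (\<phi> (fst e)) (\<phi> (tgt e))"
    obtain v where v: "v \<in> V" "opposite D e = (v, 0) \<or> opposite D e = (v, 2)"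
      using O_opp[OF e] by blast
    have tv: "tgt e = v" using v by (auto simp: tgt_def)
    have e': "e = opposite D (v, 0) \<or> e = opposite D (v, 2)"
      using v(2) opp_opp[OF O_cd[OF e]] by auto
    let ?p = "\<phi> (fst (opposite D (v, 0)))" and ?q = "\<phi> (fst (opposite D (v, 2)))"
    have pq: "?q = ?p \<star>\<^bsub>Q\<^esub> \<phi> v"
      using crossing_col[OF v(1)] under_col[OF v(1)] by simp
    have el: "?p \<in> elems Q" "?q \<in> elems Q" "\<phi> v \<in> elems Q"
      using \<phi>_el src_V under_opp[OF v(1)] v(1) by blast+
    have qp: "?p = ?q \<star>\<^bsub>Q\<^esub> \<phi> v" using pq star_invol[OF Q el(1,3)] by simp
    have "opposite D (v, 0) \<in> {e \<in> Ov. tgt e = v}" "opposite D (v, 2) \<in> {e \<in> Ov. tgt e = v}"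
      unfolding in_edges[OF v(1)] by simp_all
    moreover from e' have "lt (\<phi> v) ?q \<or> lt (\<phi> v) ?p"
    proof
      assume "e = opposite D (v, 0)"
      then have "lt ?p (\<phi> v)" using less unfolding tv by blast
      from left_order_between[OF Q lt el(1,3) this] show ?thesis unfolding pq[symmetric] ..
    next
      assume "e = opposite D (v, 2)"
      then have "lt ?q (\<phi> v)" using less unfolding tv by blast
      from left_order_between[OF Q lt el(2,3) this] show ?thesis unfolding qp[symmetric] ..
    qed
    ultimately show "\<exists>e'\<in>Ov. tgt e' = tgt e \<and> lt (\<phi> (tgt e)) (\<phi> (fst e'))"
      unfolding tv by blast
  qed
  \<comment> \<open>The subgroup generated by the relators \<open>p + q - 2 c\<close>; the coefficient of the relator of \<open>c\<close> is \<open>w c\<close>.\<close>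
  define H :: "(nat \<Rightarrow> int) set" where "H = {(\<lambda>x. \<Sum>e\<in>Ov. w (tgt e) * (of_bool (fst e = x) - of_bool (tgt e = x))) | w. True}"
  define \<delta> :: "nat \<Rightarrow> nat \<Rightarrow> int" where "\<delta> i = (\<lambda>x. of_bool (i = x))" for i
  interpret H: additive_subgroup H
  proof
    show "0 \<in> H" unfolding H_def by (rule CollectI, rule exI[of _ "\<lambda>_. 0"]) (simp add: fun_eq_iff)
    fix x y assume "x \<in> H" "y \<in> H"
    then obtain w w' where
      "x = (\<lambda>x. \<Sum>e\<in>Ov. w (tgt e) * (of_bool (fst e = x) - of_bool (tgt e = x)))"
      "y = (\<lambda>x. \<Sum>e\<in>Ov. w' (tgt e) * (of_bool (fst e = x) - of_bool (tgt e = x)))"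
      by (auto simp: H_def)
    then have "x - y = (\<lambda>x. \<Sum>e\<in>Ov. (w (tgt e) - w' (tgt e)) * (of_bool (fst e = x) - of_bool (tgt e = x)))"
      by (simp add: fun_eq_iff sum_subtractf[symmetric] left_diff_distrib)
    then show "x - y \<in> H" unfolding H_def by (intro CollectI exI[of _ "\<lambda>v. w v - w' v"]) simp
  qed
  \<comment> \<open>The crossing at which an edge passes over.  On the edge of a crossingless circle it has some value,
    which is harmless: its coloring condition is void.\<close>
  define over where "over l = fst (SOME e. e \<in> Ov \<and> label D e = l)" for l
  have over: "over (label D e) = fst e" if e: "e \<in> Ov" for e
  proof -
    define e' where "e' = (SOME e'. e' \<in> Ov \<and> label D e' = label D e)"
    have e': "e' \<in> Ov" "label D e' = label D e"
      using someI[of "\<lambda>e'. e' \<in> Ov \<and> label D e' = label D e" e] e by (auto simp: e'_def)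
    have "e' = e"
    proof (rule ccontr)
      assume "e' \<noteq> e"
      then have "opposite D e = e'"
        using e e' by (intro opposite_eqI[OF cl]) (auto dest: O_cd cd_darts)
      then show False using opp_par[OF O_cd[OF e]] e e'(1) by (simp add: Ov_def)
    qed
    then show ?thesis by (simp add: over_def e'_def)
  qed
  define g where "g l = coset H (\<delta> (over l))" for l
  have g_O: "g (label D e) = coset H (\<delta> (fst e))" if "e \<in> Ov" for e
    by (simp add: g_def over[OF that])
  have "coloring (core_quotient H) D g"
    unfolding coloring_def
  proof (intro conjI ballI)
    show "g l \<in> elems (core_quotient H)" for l by (simp add: g_def H.elems_core_quotient)
    fix v assume "v \<in> set D"
    then obtain i where i: "i < length D" "v = D ! i" by (auto simp: in_set_conv_nth)
    show "obeys (core_quotient H) g v"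
    proof (cases v)
      case (Joint a b)
      then show ?thesis using red \<open>v \<in> set D\<close> by auto
    next
      case (Crossing a b c d)
      then have V: "i \<in> V" using i by (simp add: V_def)
      let ?p = "fst (opposite D (i, 0))" and ?q = "fst (opposite D (i, 2))"
      have lab: "label D (i, 0) = a" "label D (i, 1) = b" "label D (i, 2) = c" "label D (i, 3) = d"
        using Crossing by (simp_all add: label_def i(2)[symmetric])
      have bd: "g b = coset H (\<delta> i)" "g d = coset H (\<delta> i)"
        using g_O[of "(i, 1)"] g_O[of "(i, 3)"] V lab by (simp_all add: mem_O)
      have ac: "g a = coset H (\<delta> ?p)" "g c = coset H (\<delta> ?q)"
        using g_O[OF under_opp(1)[OF V]] g_O[OF under_opp(2)[OF V]]
          opp_label[OF under_cd(1)[OF V]] opp_label[OF under_cd(2)[OF V]] lab by simp_all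
      have "(\<Sum>e\<in>Ov. of_bool (tgt e = i) * (of_bool (fst e = x) - of_bool (tgt e = x))) =
          (of_bool (?p = x) - of_bool (i = x)) + (of_bool (?q = x) - of_bool (i = x) :: int)" for x
      proof -
        have "(\<Sum>e\<in>Ov. of_bool (tgt e = i) * (of_bool (fst e = x) - of_bool (tgt e = x))) =
            (\<Sum>e\<in>Ov. if tgt e = i then of_bool (fst e = x) - of_bool (i = x) else (0 :: int))"
          by (rule sum.cong) auto
        also have "\<dots> = (\<Sum>e\<in>{e \<in> Ov. tgt e = i}. of_bool (fst e = x) - of_bool (i = x))"
          by (rule sum.inter_filter[OF finite_E, symmetric])
        finally show ?thesis unfolding in_edges[OF V] using in_ne[OF V] by simp
      qed
      then have "\<delta> ?q - (\<delta> i + \<delta> i - \<delta> ?p) =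
          (\<lambda>x. \<Sum>e\<in>Ov. of_bool (tgt e = i) * (of_bool (fst e = x) - of_bool (tgt e = x)))"
        by (simp add: fun_eq_iff \<delta>_def)
      then have "\<delta> ?q - (\<delta> i + \<delta> i - \<delta> ?p) \<in> H"
        unfolding H_def by (intro CollectI exI[of _ "\<lambda>v. of_bool (v = i)"]) simp
      then show ?thesis
        unfolding Crossing obeys.simps bd ac H.star_coset H.coset_eq_iff by (simp add: H.zero_mem)
    qed
  qed
  with H.involutory_core_quotient have "\<exists>h. magma_hom Q (core_quotient H) h \<and> (\<forall>e\<in>edges D. g e = h (f e))"
    by (intro f[unfolded universal_coloring_def, THEN conjunct2, rule_format] conjI)
  then obtain h where h: "\<And>e. e \<in> edges D \<Longrightarrow> g e = h (f e)" by blast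
  have "\<exists>e\<in>Ov. fst e = tgt e"
  proof (rule loop_if_one_edge_cuts)
    show "V \<noteq> {}" using cross by (auto simp: V_def in_set_conv_nth)
    fix e assume e: "e \<in> Ov" "fst e \<noteq> tgt e"
    have t: "(tgt e, 1) \<in> Ov" using tgt_V[OF e(1)] by (simp add: mem_O)
    have "f (label D e) = f (label D (tgt e, 1))"
      using label_O[OF e(1)] label_O[OF t] const[OF e(1)] by simp
    then have "g (label D e) = g (label D (tgt e, 1))"
      using h label_in_edges e(1) t O_cd cd_darts by simp
    then have "\<delta> (fst e) - \<delta> (tgt e) \<in> H"
      using g_O[OF e(1)] g_O[OF t] by (simp add: H.coset_eq_iff)
    then obtain w where w: "\<delta> (fst e) - \<delta> (tgt e) =
        (\<lambda>x. \<Sum>e\<in>Ov. w (tgt e) * (of_bool (fst e = x) - of_bool (tgt e = x)))"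
      by (auto simp: H_def)
    show "\<exists>S\<subseteq>V. card (out_cut S) = 1 \<and> fst e \<notin> S \<and> tgt e \<in> S"
    proof (rule one_edge_cut_if_integer_potential[OF e])
      fix x assume x: "x \<in> V"
      show "(\<Sum>e'\<in>{e' \<in> Ov. fst e' = x}. w (tgt e') - w x) = of_bool (x = fst e) - of_bool (x = tgt e)"
        unfolding relation_as_laplacian[OF x, symmetric] using fun_cong[OF w, of x]
        by (simp add: \<delta>_def eq_commute)
    qed
  qed
  then obtain e where e: "e \<in> Ov" "fst e = tgt e" by blast
  then obtain i s where es: "e = (i, s)" "i \<in> V" "s = 1 \<or> s = 3" by (cases e) (auto simp: mem_O)
  obtain t where t: "opposite D e = (i, t)" "t = 0 \<or> t = 2"
    using O_opp[OF e(1)] e(2) es(1) by (auto simp: tgt_def)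
  obtain a b c d where v: "D ! i = Crossing a b c d" "Crossing a b c d \<in> set D"
    using V_ends[OF es(2)] by blast
  have "label D (i, t) = label D (i, s)" using opp_label[OF O_cd[OF e(1)]] t(1) es(1) by simp
  then have "a = b \<or> b = c \<or> c = d \<or> d = a"
    using es(3) t(2) v(1) by (auto simp: label_def)
  then show ?thesis using v(2) by blast
qed

section \<open>Reduction to a diagram without crossings\<close>

lemma link_equivI:
  assumes "link_diagram D" "link_diagram D'" "move D D'"
  shows "(D, D') \<in> link_equiv"
  using assms by (auto simp: link_equiv_def intro!: eq_closure_base)

lemma link_equiv_trans: "(D, D') \<in> link_equiv \<Longrightarrow> (D', D'') \<in> link_equiv \<Longrightarrow> (D, D'') \<in> link_equiv"
  using equiv_link_equiv unfolding equiv_def by (blast dest: transD)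

text \<open>
  Removing a joint shortens the diagram, and removing a kink replaces a crossing by a joint.
\<close>

definition complexity :: "diagram \<Rightarrow> nat" where
  "complexity D = length D + length (filter is_crossing D)"

lemma permute_to_front:
  assumes "v \<in> set D" "link_diagram D" "alternating_diagram D"
  obtains D' where "(D, v # D') \<in> link_equiv" "link_diagram (v # D')" "alternating_diagram (v # D')"
    "mset D = mset (v # D')" "complexity (v # D') = complexity D"
proof -
  obtain xs ys where D: "D = xs @ v # ys" using assms(1) by (auto simp: in_set_conv_decomp)
  have ms: "mset (v # xs @ ys) = mset D" by (simp add: D)
  show thesis
  proof (rule that[of "xs @ ys"])
    show "link_diagram (v # xs @ ys)" using ms assms(2) by (rule permute_link_diagram)
    then show "(D, v # xs @ ys) \<in> link_equiv"
      using assms(2) ms by (intro link_equivI move.permute) simp_all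
    show "alternating_diagram (v # xs @ ys)" using ms assms(2,3) by (rule permute_link_diagram)
  qed (simp_all add: D complexity_def)
qed

text \<open>
  A kink occupies two cyclically adjacent positions; up to half a turn of the crossing, these are among the
  first three.
\<close>

lemma kink_removal:
  assumes "link_diagram D" "alternating_diagram D"
    and v: "Crossing a b c d \<in> set D" "a = b \<or> b = c \<or> c = d \<or> d = a"
    and red: "\<And>p q. Joint p q \<in> set D \<Longrightarrow> p = q"
  shows "\<exists>D'. (D, D') \<in> link_equiv \<and> link_diagram D' \<and> alternating_diagram D' \<and>
    complexity D' < complexity D"
proof -
  obtain D0 where D0: "(D, Crossing a b c d # D0) \<in> link_equiv" "link_diagram (Crossing a b c d # D0)"
    "alternating_diagram (Crossing a b c d # D0)" "mset D = mset (Crossing a b c d # D0)"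
    "complexity (Crossing a b c d # D0) = complexity D"
    using permute_to_front[OF v(1) assms(1,2)] by blast
  have red0: "p = q" if "Joint p q \<in> set D0" for p q
    using red that mset_eq_setD[OF D0(4)] by simp
  let ?P = "\<lambda>D1. \<exists>D'. (D1, D') \<in> link_equiv \<and> link_diagram D' \<and> alternating_diagram D' \<and>
    complexity D' < complexity D1"
  have front: "?P (Crossing a b c d # D0)"
    if v: "a = b \<or> b = c" and D1: "link_diagram (Crossing a b c d # D0)" "alternating_diagram (Crossing a b c d # D0)"
    for a b c d
    using v
  proof
    assume "a = b"
    with D1 have D1: "link_diagram (Crossing a a c d # D0)" "alternating_diagram (Crossing a a c d # D0)" by simp_all
    have D2: "link_diagram (Joint c d # D0)" using D1(1) by (rule R1_link_diagram)
    moreover have "alternating_diagram (Joint c d # D0)"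
      by (rule R1_alternating[of "Crossing a a c d" a]) (use D1 red0 in \<open>simp_all add: link_diagram_iff\<close>)
    moreover have "(Crossing a a c d # D0, Joint c d # D0) \<in> link_equiv"
      using D1(1) D2 by (intro link_equivI move.R1)
    ultimately show ?thesis using \<open>a = b\<close> by (auto simp: complexity_def)
  next
    assume "b = c"
    with D1 have D1: "link_diagram (Crossing a b b d # D0)" "alternating_diagram (Crossing a b b d # D0)" by simp_all
    have D2: "link_diagram (Joint a d # D0)" using D1(1) by (rule R1'_link_diagram)
    moreover have "alternating_diagram (Joint a d # D0)"
      by (rule R1_alternating[of "Crossing a b b d" b]) (use D1 red0 in \<open>simp_all add: link_diagram_iff\<close>)
    moreover have "(Crossing a b b d # D0, Joint a d # D0) \<in> link_equiv"
      using D1(1) D2 by (intro link_equivI move.R1')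
    ultimately show ?thesis using \<open>b = c\<close> by (auto simp: complexity_def)
  qed
  have "?P (Crossing a b c d # D0)"
  proof (cases "a = b \<or> b = c")
    case True
    then show ?thesis using front D0(2,3) by blast
  next
    case False
    then have cd: "c = d \<or> d = a" using v(2) by blast
    have D1: "link_diagram (Crossing c d a b # D0)" "alternating_diagram (Crossing c d a b # D0)"
      using turn_crossing_link_diagram turn_crossing_alternating D0(2,3) by blast+
    then obtain D' where D': "(Crossing c d a b # D0, D') \<in> link_equiv" "link_diagram D'"
      "alternating_diagram D'" "complexity D' < complexity (Crossing c d a b # D0)"
      using front[OF cd D1] by blast
    have "(Crossing a b c d # D0, Crossing c d a b # D0) \<in> link_equiv"
      using D0(2) D1(1) by (intro link_equivI move.turn_crossing)
    then have "(Crossing a b c d # D0, D') \<in> link_equiv" using D'(1) by (rule link_equiv_trans)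
    then show ?thesis using D' by (auto simp: complexity_def)
  qed
  then show ?thesis using D0(1,5) link_equiv_trans by metis
qed

lemma joint_removal:
  assumes "link_diagram D" "alternating_diagram D" and v: "Joint a b \<in> set D" "a \<noteq> b"
  shows "\<exists>D'. (D, D') \<in> link_equiv \<and> link_diagram D' \<and> alternating_diagram D' \<and>
    complexity D' < complexity D"
proof -
  obtain D0 where D0: "(D, Joint a b # D0) \<in> link_equiv" "link_diagram (Joint a b # D0)"
    "alternating_diagram (Joint a b # D0)" "complexity (Joint a b # D0) = complexity D"
    using permute_to_front[OF v(1) assms(1,2)] by blast
  let ?D' = "map (relabel (id(b := a))) D0"
  have D': "link_diagram ?D'" using v(2) D0(2) by (rule remove_joint_link_diagram)
  then have "(Joint a b # D0, ?D') \<in> link_equiv"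
    using D0(2) v(2) by (intro link_equivI move.remove_joint)
  then have "(D, ?D') \<in> link_equiv" using D0(1) link_equiv_trans by blast
  moreover have "alternating_diagram ?D'" using D0(3) by (rule remove_joint_alternating)
  moreover have "complexity ?D' < complexity D"
    unfolding D0(4)[symmetric] by (simp add: complexity_def filter_map o_def)
  ultimately show ?thesis using D' by blast
qed

lemma alternating_simplifies:
  assumes Q: "involutory_quandle Q" and lt: "left_order_on Q lt"
    and "link_diagram D" "alternating_diagram D" "\<exists>f. universal_coloring Q D f"
  shows "\<exists>D'. (D, D') \<in> link_equiv \<and> (\<forall>v\<in>set D'. \<not> is_crossing v)"
  using assms(3-5)
proof (induction "complexity D" arbitrary: D rule: less_induct)
  case less
  show ?case
  proof (cases "\<exists>v\<in>set D. is_crossing v")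
    case False
    then show ?thesis using less.prems(1) equiv_link_equiv by (auto simp: equiv_def refl_on_def)
  next
    case True
    have "\<exists>D'. (D, D') \<in> link_equiv \<and> link_diagram D' \<and> alternating_diagram D' \<and>
      complexity D' < complexity D"
    proof (cases "\<exists>a b. Joint a b \<in> set D \<and> a \<noteq> b")
      case True
      then show ?thesis using joint_removal less.prems(1,2) by blast
    next
      case False
      then have red: "\<And>p q. Joint p q \<in> set D \<Longrightarrow> p = q" by blast
      obtain f where f: "universal_coloring Q D f" using less.prems(3) by blast
      have cl: "paired_ends D" using less.prems(1) by (simp add: link_diagram_iff)
      obtain a b c d where "Crossing a b c d \<in> set D" "a = b \<or> b = c \<or> c = d \<or> d = a"
        using kink_exists[OF cl less.prems(2) red True Q lt f] by blast
      then show ?thesis using kink_removal[OF less.prems(1,2) _ _ red] by blast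
    qed
    then obtain D' where D': "(D, D') \<in> link_equiv" "link_diagram D'" "alternating_diagram D'"
      "complexity D' < complexity D" by blast
    have "\<exists>f. universal_coloring Q D' f"
      using universal_coloring_link_equiv[OF Q D'(1)] less.prems(3) by blast
    then obtain D'' where "(D', D'') \<in> link_equiv" "\<forall>v\<in>set D''. \<not> is_crossing v"
      using less.hyps[OF D'(4) D'(2,3)] by blast
    then show ?thesis using D'(1) link_equiv_trans by blast
  qed
qed

text \<open>
  The universal coloring of \<open>D\<close> by \<open>IQ D\<close> is transported to an alternating diagram of the same link.
  A left-order on \<open>IQ D\<close> then forces kinks in that diagram until no crossing is left.
\<close>

theorem theorem4p1:
  assumes "L \<in> links"
    and "alternating_link L"
    and "\<not> unlink L"
    and "D \<in> L"
  shows "\<not> left_orderable (IQ D)"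
proof
  assume "left_orderable (IQ D)"
  then obtain lt where lt: "left_order_on (IQ D) lt" by (auto simp: left_orderable_def)
  have Q: "involutory_quandle (IQ D)" unfolding IQ_def by (rule involutory_quandle_presented_iq)
  note L = assms(1)[unfolded links_def]
  obtain D' where D': "D' \<in> L" "alternating_diagram D'"
    using assms(2) by (auto simp: alternating_link_def)
  have "(D, D') \<in> link_equiv"
    using quotient_eq_iff[OF equiv_link_equiv L L assms(4) D'(1)] by simp
  then have "\<exists>f. universal_coloring (IQ D) D' f"
    using universal_coloring_link_equiv[OF Q] universal_coloring_IQ by blast
  moreover have "link_diagram D'" using in_quotient_imp_subset[OF equiv_link_equiv L] D'(1) by blast
  ultimately obtain D'' where D'': "(D', D'') \<in> link_equiv" "\<forall>v\<in>set D''. \<not> is_crossing v"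
    using alternating_simplifies[OF Q lt _ D'(2)] by blast
  then have "D'' \<in> L" using in_quotient_imp_closed[OF equiv_link_equiv L D'(1)] by blast
  then show False using assms(3) D''(2) by (auto simp: unlink_def)
qed

end
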